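(* Let $B_w$ be a mixing weighted backward shift on the space $H(\mathbb{C})$ of entire functions, considered as a Fréchet sequence algebra under the pointwise product of functions. Then the set $HC(B_w)$ of hypercyclic vectors for $B_w$ is algebrable. This applies, in particular, to the MacLane operator $D$ of differentiation, $Df=f'$.
   Context: $H(\mathbb{C})$ carries the topology of uniform convergence on compact sets and is identified with a space of sequences via Taylor coefficients at $0$, $f(z)=\sum_{n\ge0}a_nz^n\leftrightarrow(a_n)_{n\ge0}$. The topology is induced by the seminorms $\|(a_n)_n\|_q=\sup_{|z|\le q}|\sum_{n=0}^\infty a_nz^n|$, $q\ge1$. The pointwise product of functions corresponds to the Cauchy product of coefficient sequences. A weight is a sequence $w=(w_n)_{n\ge0}$ of non-zero complex numbers, with the convention $w_0=1$. The weighted backward shift is $B_w(a_0,a_1,a_2,\dots)=(w_1a_1,w_2a_2,w_3a_3,\dots)$; saying that it is a weighted backward shift on $X=H(\mathbb{C})$ means that it maps $X$ into $X$ (it is then a continuous linear operator on $X$). The operator $D$ is the weighted backward shift with $w_n=n$, $n\ge1$. An operator $T$ on $X$ is mixing if for any non-empty open $U,V\subset X$ the set $\{n\ge0:T^n(U)\cap V\ne\varnothing\}$ is co-finite. $HC(T)=\{x\in X:\{x,Tx,T^2x,\dots\}\text{ is dense in }X\}$. $HC(T)$ is algebrable if $HC(T)\cup\{0\}$ contains a subalgebra of $X$ (here for the pointwise product) that is infinitely but not finitely generated. Algebras are not required to be unital; the algebra generated by a set is the smallest subalgebra containing it (the linear span of all finite products of at least one element of the set), and an algebra is finitely generated if it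 is generated by a finite subset. *)

theory Defs
  imports "HOL-Complex_Analysis.Complex_Analysis"
begin

definition entire_functions :: "(complex \<Rightarrow> complex) set" where
  "entire_functions = {f. f holomorphic_on UNIV}"

definition sup_seminorm :: "nat \<Rightarrow> (complex \<Rightarrow> complex) \<Rightarrow> real" where
  "sup_seminorm q f = (SUP z\<in>cball 0 (real q). norm (f z))"

text \<open>The seminorms increase with \<open>q\<close> on entire functions, so the balls of a single
  seminorm already form a neighbourhood base.\<close>

definition entire_open :: "(complex \<Rightarrow> complex) set \<Rightarrow> bool" where
  "entire_open U \<longleftrightarrow> U \<subseteq> entire_functions \<and>
     (\<forall>f\<in>U. \<exists>q\<ge>1. \<exists>e>0. \<forall>g\<in>entire_functions.
        sup_seminorm q (\<lambda>z. g z - f z) < e \<longrightarrow> g \<in> U)"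

definition entire_topology :: "(complex \<Rightarrow> complex) topology" where
  "entire_topology = topology entire_open"

lemma sup_seminorm_mono:
  assumes "f \<in> entire_functions" "p \<le> q"
  shows "sup_seminorm p f \<le> sup_seminorm q f"
proof -
  have "continuous_on (cball 0 (real q)) f"
    using assms(1) unfolding entire_functions_def
    by (auto intro: holomorphic_on_imp_continuous_on holomorphic_on_subset)
  then have "compact ((\<lambda>z. norm (f z)) ` cball 0 (real q))"
    by (intro compact_continuous_image continuous_intros) auto
  then have "bdd_above ((\<lambda>z. norm (f z)) ` cball 0 (real q))"
    by (intro bounded_imp_bdd_above compact_imp_bounded)
  then show ?thesis
    unfolding sup_seminorm_def using assms(2) by (intro cSUP_subset_mono) auto
qed

lemma istopology_entire_open: "istopology entire_open"
  unfolding istopology_def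
proof (intro conjI allI impI)
  fix U V assume U: "entire_open U" and V: "entire_open V"
  show "entire_open (U \<inter> V)"
    unfolding entire_open_def
  proof (intro conjI ballI)
    show "U \<inter> V \<subseteq> entire_functions"
      using U unfolding entire_open_def by blast
    fix f assume f: "f \<in> U \<inter> V"
    then have fe: "f \<in> entire_functions"
      using U unfolding entire_open_def by blast
    obtain p d where p: "p \<ge> 1" "d > 0"
      "\<And>g. g \<in> entire_functions \<Longrightarrow> sup_seminorm p (\<lambda>z. g z - f z) < d \<Longrightarrow> g \<in> U"
      using U f unfolding entire_open_def by blast
    obtain q e where q: "q \<ge> 1" "e > 0"
      "\<And>g. g \<in> entire_functions \<Longrightarrow> sup_seminorm q (\<lambda>z. g z - f z) < e \<Longrightarrow> g \<in> V"
      using V f unfolding entire_open_def by blast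
    show "\<exists>q\<ge>1. \<exists>e>0. \<forall>g\<in>entire_functions.
        sup_seminorm q (\<lambda>z. g z - f z) < e \<longrightarrow> g \<in> U \<inter> V"
    proof (intro exI[of _ "max p q"] exI[of _ "min d e"] conjI ballI impI)
      fix g assume g: "g \<in> entire_functions"
        and lt: "sup_seminorm (max p q) (\<lambda>z. g z - f z) < min d e"
      have "(\<lambda>z. g z - f z) \<in> entire_functions"
        using g fe unfolding entire_functions_def by (auto intro: holomorphic_intros)
      then have "sup_seminorm p (\<lambda>z. g z - f z) < d" "sup_seminorm q (\<lambda>z. g z - f z) < e"
        using lt sup_seminorm_mono[of "\<lambda>z. g z - f z" p "max p q"]
          sup_seminorm_mono[of "\<lambda>z. g z - f z" q "max p q"] by auto
      then show "g \<in> U \<inter> V"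
        using p(3) q(3) g by blast
    qed (use p q in auto)
  qed
next
  fix K assume "\<forall>U\<in>K. entire_open U"
  then have K: "\<And>U. U \<in> K \<Longrightarrow> entire_open U"
    by blast
  show "entire_open (\<Union>K)"
    unfolding entire_open_def
  proof (intro conjI ballI)
    show "\<Union>K \<subseteq> entire_functions"
      using K unfolding entire_open_def by blast
    fix f assume "f \<in> \<Union>K"
    then obtain U where U: "U \<in> K" "f \<in> U"
      by blast
    obtain q e where q: "q \<ge> 1" "e > 0"
      "\<And>g. g \<in> entire_functions \<Longrightarrow> sup_seminorm q (\<lambda>z. g z - f z) < e \<Longrightarrow> g \<in> U"
      using K[OF U(1)] U(2) unfolding entire_open_def by blast
    show "\<exists>q\<ge>1. \<exists>e>0. \<forall>g\<in>entire_functions.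
        sup_seminorm q (\<lambda>z. g z - f z) < e \<longrightarrow> g \<in> \<Union>K"
      by (intro exI[of _ q] exI[of _ e] conjI ballI impI) (use q U(1) in blast)+
  qed
qed

lemma openin_entire_topology: "openin entire_topology = entire_open"
  unfolding entire_topology_def by (rule topology_inverse'[OF istopology_entire_open])

lemma topspace_entire_topology: "topspace entire_topology = entire_functions"
proof -
  have "entire_open entire_functions"
    unfolding entire_open_def by (meson order_refl zero_less_one)
  then show ?thesis
    unfolding topspace_def openin_entire_topology using entire_open_def by blast
qed

definition mixing :: "'a topology \<Rightarrow> ('a \<Rightarrow> 'a) \<Rightarrow> bool" where
  "mixing X T \<longleftrightarrow>
     (\<forall>U V. openin X U \<longrightarrow> openin X V \<longrightarrow> U \<noteq> {} \<longrightarrow> V \<noteq> {} \<longrightarrow>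
        finite (- {n. (T ^^ n) ` U \<inter> V \<noteq> {}}))"

definition hypercyclic_vectors :: "'a topology \<Rightarrow> ('a \<Rightarrow> 'a) \<Rightarrow> 'a set" where
  "hypercyclic_vectors X T =
     {x \<in> topspace X. X closure_of (range (\<lambda>n. (T ^^ n) x)) = topspace X}"

definition weight :: "(nat \<Rightarrow> complex) \<Rightarrow> bool" where
  "weight w \<longleftrightarrow> w 0 = 1 \<and> (\<forall>n. w n \<noteq> 0)"

text \<open>A coefficient sequence is represented by the formal power series having these coefficients;
  it belongs to an entire function iff the radius of convergence is infinite.\<close>

definition shift_coeffs :: "(nat \<Rightarrow> complex) \<Rightarrow> complex fps \<Rightarrow> complex fps" where
  "shift_coeffs w F = Abs_fps (\<lambda>n. w (Suc n) * fps_nth F (Suc n))"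

definition backward_shift ::
    "(nat \<Rightarrow> complex) \<Rightarrow> (complex \<Rightarrow> complex) \<Rightarrow> (complex \<Rightarrow> complex)" where
  "backward_shift w f = eval_fps (shift_coeffs w (fps_expansion f 0))"

text \<open>That the shift maps \<open>H(\<complex>)\<close> into itself is expressed by the radius of convergence, because
  \<^const>\<open>eval_fps\<close> has an arbitrary value wherever the series diverges.\<close>

definition entire_weighted_shift :: "(nat \<Rightarrow> complex) \<Rightarrow> bool" where
  "entire_weighted_shift w \<longleftrightarrow> weight w \<and>
     (\<forall>f\<in>entire_functions. fps_conv_radius (shift_coeffs w (fps_expansion f 0)) = \<infinity>)"

definition maclane_weight :: "nat \<Rightarrow> complex" where
  "maclane_weight n = (if n = 0 then 1 else of_nat n)"

text \<open>Algebras are complex and not necessarily unital.\<close>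

definition entire_subalgebra :: "(complex \<Rightarrow> complex) set \<Rightarrow> bool" where
  "entire_subalgebra A \<longleftrightarrow> A \<subseteq> entire_functions \<and> (\<lambda>z. 0) \<in> A \<and>
     (\<forall>f\<in>A. \<forall>g\<in>A. (\<lambda>z. f z + g z) \<in> A) \<and>
     (\<forall>c. \<forall>f\<in>A. (\<lambda>z. c * f z) \<in> A) \<and>
     (\<forall>f\<in>A. \<forall>g\<in>A. (\<lambda>z. f z * g z) \<in> A)"

text \<open>The inclusion \<open>S \<subseteq> A\<close> is needed: for \<open>S\<close> not contained in \<^const>\<open>entire_functions\<close>
  the hull is an empty intersection.\<close>

definition generates :: "(complex \<Rightarrow> complex) set \<Rightarrow> (complex \<Rightarrow> complex) set \<Rightarrow> bool" where
  "generates S A \<longleftrightarrow> S \<subseteq> A \<and> entire_subalgebra hull S = A"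

definition algebrable :: "(complex \<Rightarrow> complex) set \<Rightarrow> bool" where
  "algebrable M \<longleftrightarrow>
     (\<exists>A. entire_subalgebra A \<and> A \<subseteq> M \<union> {\<lambda>z. 0} \<and>
        (\<exists>S. infinite S \<and> generates S A) \<and>
        \<not> (\<exists>S. finite S \<and> generates S A))"

end

theory Submission
  imports Defs
begin

text \<open>Let \<open>v\<^sub>n = w\<^sub>1 \<cdots> w\<^sub>n\<close>, so that \<open>B\<^sup>N\<close> sends \<open>z\<^bsup>n+N\<^esup>\<close> to \<open>(v\<^bsub>n+N\<^esub> / v\<^sub>n) z\<^sup>n\<close>. Continuity bounds \<open>w\<^sub>n\<close> by \<open>C\<^sup>n\<close>, and
  mixing forces \<open>\<bar>v\<^sub>n\<bar>\<close> to grow faster than every \<open>R\<^sup>n\<close>. Hence small lacunary perturbations of two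
  polynomials \<open>f, g\<close> can be chosen such that, for a suitable \<open>N\<close>, \<open>B\<^sup>N\<close> maps a prescribed monomial
  \<open>f\<^sup>a g\<^sup>b\<close>, \<open>a \<ge> 1\<close>, close to a prescribed target and annihilates all lower monomials, whose degrees
  are less than \<open>N\<close>. By Baire category some pair of entire functions has this property
  approximately for all exponents and all targets in a countable dense set. Then every nonzero
  combination of monomials \<open>f\<^sup>a g\<^sup>b\<close> with \<open>a \<ge> 1\<close> is hypercyclic. In particular these monomials are
  linearly independent, so their span is an algebra that is not finitely generated, just as the
  ideal \<open>x \<complex>[x, y]\<close> is not finitely generated as an algebra.\<close>

section \<open>Entire functions and their Taylor coefficients\<close>

abbreviation taylor :: "(complex \<Rightarrow> complex) \<Rightarrow> complex fps" where
  "taylor f \<equiv> fps_expansion f 0"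

lemma entire_functionsD: "f \<in> entire_functions \<Longrightarrow> f holomorphic_on A"
  unfolding entire_functions_def by (auto intro: holomorphic_on_subset)

lemma entire_functionsI: "f holomorphic_on UNIV \<Longrightarrow> f \<in> entire_functions"
  unfolding entire_functions_def by auto

lemma entire_intros:
  "(\<lambda>z. c) \<in> entire_functions"
  "f \<in> entire_functions \<Longrightarrow> g \<in> entire_functions \<Longrightarrow> (\<lambda>z. f z + g z) \<in> entire_functions"
  "f \<in> entire_functions \<Longrightarrow> g \<in> entire_functions \<Longrightarrow> (\<lambda>z. f z - g z) \<in> entire_functions"
  "f \<in> entire_functions \<Longrightarrow> g \<in> entire_functions \<Longrightarrow> (\<lambda>z. f z * g z) \<in> entire_functions"
  "f \<in> entire_functions \<Longrightarrow> (\<lambda>z. f z ^ n) \<in> entire_functions"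
  "poly P \<in> entire_functions"
  unfolding entire_functions_def by (auto intro!: holomorphic_intros)

lemma entire_sum:
  "(\<And>i. i \<in> I \<Longrightarrow> f i \<in> entire_functions) \<Longrightarrow> (\<lambda>z. \<Sum>i\<in>I. f i z) \<in> entire_functions"
  unfolding entire_functions_def by (auto intro!: holomorphic_intros)

lemma conv_radius_taylor:
  assumes "f \<in> entire_functions"
  shows "fps_conv_radius (taylor f) = \<infinity>"
  using conv_radius_fps_expansion[of f 0 \<infinity>] entire_functionsD[OF assms] by auto

lemma eval_taylor:
  assumes "f \<in> entire_functions"
  shows "eval_fps (taylor f) z = f z"
  using eval_fps_expansion'[of f 0 \<infinity> z] entire_functionsD[OF assms] by auto

lemma taylor_eval:
  assumes "fps_conv_radius F = \<infinity>"
  shows "taylor (eval_fps F) = F"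
  using fps_nth_fps_expansion[OF eval_fps_has_fps_expansion[of F]] assms
  by (intro fps_ext) (simp add: fps_expansion_def)

lemma eval_fps_entire:
  assumes "fps_conv_radius F = \<infinity>"
  shows "eval_fps F \<in> entire_functions"
  using assms by (intro entire_functionsI holomorphic_on_eval_fps) auto

lemma taylor_unique:
  assumes "fps_conv_radius F = \<infinity>" "\<And>z. f z = eval_fps F z"
  shows "taylor f = F"
proof -
  have "f = eval_fps F" using assms(2) by auto
  then show ?thesis using taylor_eval[OF assms(1)] by simp
qed

lemma entire_eqI:
  assumes "f \<in> entire_functions" "g \<in> entire_functions" "taylor f = taylor g"
  shows "f = g"
  using eval_taylor[OF assms(1)] eval_taylor[OF assms(2)] assms(3) by (metis ext)

lemma taylor_add:
  assumes "f \<in> entire_functions" "g \<in> entire_functions"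
  shows "taylor (\<lambda>z. f z + g z) = taylor f + taylor g"
proof (rule taylor_unique)
  show "fps_conv_radius (taylor f + taylor g) = \<infinity>"
    using fps_conv_radius_add[of "taylor f" "taylor g"] conv_radius_taylor assms by auto
  show "f z + g z = eval_fps (taylor f + taylor g) z" for z
    by (subst eval_fps_add) (auto simp: conv_radius_taylor eval_taylor assms)
qed

lemma taylor_cmult:
  assumes "f \<in> entire_functions"
  shows "taylor (\<lambda>z. c * f z) = fps_const c * taylor f"
proof (rule taylor_unique)
  show "fps_conv_radius (fps_const c * taylor f) = \<infinity>"
    using fps_conv_radius_mult[of "fps_const c" "taylor f"] conv_radius_taylor assms by auto
  show "c * f z = eval_fps (fps_const c * taylor f) z" for z
    by (subst eval_fps_mult) (auto simp: conv_radius_taylor eval_taylor assms)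
qed

lemma taylor_poly: "taylor (poly P) = fps_of_poly P"
  by (rule taylor_unique) auto

lemma sup_seminorm_le:
  assumes "\<And>z. norm z \<le> real q \<Longrightarrow> norm (f z) \<le> c"
  shows "sup_seminorm q f \<le> c"
  unfolding sup_seminorm_def using assms by (intro cSUP_least) auto

lemma le_sup_seminorm:
  assumes "f \<in> entire_functions" "norm z \<le> real q"
  shows "norm (f z) \<le> sup_seminorm q f"
proof -
  have "continuous_on (cball 0 (real q)) f"
    using assms(1) by (intro holomorphic_on_imp_continuous_on entire_functionsD)
  then have "compact ((\<lambda>z. norm (f z)) ` cball 0 (real q))"
    by (intro compact_continuous_image continuous_intros) auto
  then have "bdd_above ((\<lambda>z. norm (f z)) ` cball 0 (real q))"
    by (intro bounded_imp_bdd_above compact_imp_bounded)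
  then show ?thesis
    unfolding sup_seminorm_def using assms(2) by (intro cSUP_upper) auto
qed

lemma taylor_coeff_bound:
  assumes "f \<in> entire_functions" "q \<ge> 1"
    and "\<And>z. norm z \<le> real q \<Longrightarrow> norm (f z) \<le> M"
  shows "norm (fps_nth (taylor f) n) \<le> M / real q ^ n"
proof -
  have "norm ((deriv ^^ n) f 0) \<le> fact n * M / real q ^ n"
    using assms(2,3) entire_functionsD[OF assms(1)]
    by (intro Cauchy_inequality holomorphic_on_imp_continuous_on) auto
  then show ?thesis
    by (simp add: fps_expansion_def norm_divide field_simps)
qed

lemma poly_approx_entire:
  assumes f: "f \<in> entire_functions" and "e > 0"
  obtains P where "\<And>z. norm z \<le> r \<Longrightarrow> norm (f z - poly P z) \<le> e"
proof -
  let ?a = "fps_nth (taylor f)"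
  have "ereal r < conv_radius ?a"
    using conv_radius_taylor[OF f] by (simp add: fps_conv_radius_def)
  from powser_uniform_limit[OF this, of 0] \<open>e > 0\<close>
  obtain n where n: "\<And>z. z \<in> cball 0 r \<Longrightarrow>
      dist (\<Sum>i<n. ?a i * (z - 0) ^ i) (\<Sum>i. ?a i * (z - 0) ^ i) < e"
    unfolding uniform_limit_iff eventually_sequentially by blast
  define P where "P = (\<Sum>i<n. monom (?a i) i)"
  have "norm (f z - poly P z) \<le> e" if "norm z \<le> r" for z
  proof -
    have "poly P z = (\<Sum>i<n. ?a i * z ^ i)"
      by (simp add: P_def poly_sum poly_monom)
    moreover have "f z = (\<Sum>i. ?a i * z ^ i)"
      using eval_taylor[OF f, of z] by (simp add: eval_fps_def)
    ultimately show ?thesis using n[of z] that by (simp add: dist_norm norm_minus_commute)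
  qed
  then show ?thesis by (rule that)
qed

section \<open>Weighted shifts\<close>

definition weight_prod :: "(nat \<Rightarrow> complex) \<Rightarrow> nat \<Rightarrow> complex" where
  "weight_prod w n = (\<Prod>i=1..n. w i)"

lemma weight_prod_0 [simp]: "weight_prod w 0 = 1"
  by (simp add: weight_prod_def)

lemma weight_prod_Suc: "weight_prod w (Suc n) = w (Suc n) * weight_prod w n"
  by (simp add: weight_prod_def)

lemma weight_prod_nonzero: "weight w \<Longrightarrow> weight_prod w n \<noteq> 0"
  by (auto simp: weight_prod_def weight_def)

lemma shift_coeffs_funpow:
  assumes "weight w"
  shows "fps_nth ((shift_coeffs w ^^ N) F) n =
           weight_prod w (n + N) / weight_prod w n * fps_nth F (n + N)"
proof (induction N arbitrary: n)
  case 0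
  then show ?case using weight_prod_nonzero[OF assms] by simp
next
  case (Suc N)
  have "fps_nth ((shift_coeffs w ^^ Suc N) F) n
      = w (Suc n) * (weight_prod w (Suc n + N) / weight_prod w (Suc n) * fps_nth F (Suc n + N))"
    by (simp add: shift_coeffs_def Suc.IH)
  also have "\<dots> = weight_prod w (n + Suc N) / weight_prod w n * fps_nth F (n + Suc N)"
    using weight_prod_nonzero[OF assms] assms by (simp add: weight_prod_Suc weight_def)
  finally show ?case .
qed

locale entire_shift =
  fixes w :: "nat \<Rightarrow> complex"
  assumes entire_shift: "entire_weighted_shift w"
begin

abbreviation "v \<equiv> weight_prod w"
abbreviation "B \<equiv> backward_shift w"

lemma weight: "weight w"
  using entire_shift by (simp add: entire_weighted_shift_def)

lemma v_nonzero [simp]: "v n \<noteq> 0"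
  using weight_prod_nonzero[OF weight] .

lemma taylor_B:
  assumes "f \<in> entire_functions"
  shows "taylor (B f) = shift_coeffs w (taylor f)"
  using entire_shift assms unfolding backward_shift_def entire_weighted_shift_def
  by (intro taylor_eval) auto

lemma B_entire:
  assumes "f \<in> entire_functions"
  shows "B f \<in> entire_functions"
  using entire_shift assms unfolding backward_shift_def entire_weighted_shift_def
  by (intro eval_fps_entire) auto

lemma Bpow_entire: "f \<in> entire_functions \<Longrightarrow> (B ^^ N) f \<in> entire_functions"
  by (induction N) (auto intro: B_entire)

lemma taylor_Bpow:
  assumes "f \<in> entire_functions"
  shows "taylor ((B ^^ N) f) = (shift_coeffs w ^^ N) (taylor f)"
  by (induction N) (auto simp: taylor_B Bpow_entire assms)

text \<open>Linearity is read off the Taylor coefficients, which determine a function only among the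
  entire ones; hence the hypotheses on \<open>f\<close> and \<open>g\<close>.\<close>

lemma Bpow_add:
  assumes f: "f \<in> entire_functions" and g: "g \<in> entire_functions"
  shows "(B ^^ N) (\<lambda>z. f z + g z) = (\<lambda>z. (B ^^ N) f z + (B ^^ N) g z)"
proof (rule entire_eqI)
  show "taylor ((B ^^ N) (\<lambda>z. f z + g z)) = taylor (\<lambda>z. (B ^^ N) f z + (B ^^ N) g z)"
    by (intro fps_ext)
       (simp add: taylor_Bpow taylor_add entire_intros f g Bpow_entire
        shift_coeffs_funpow[OF weight] algebra_simps)
qed (intro Bpow_entire entire_intros f g)+

lemma Bpow_cmult:
  assumes f: "f \<in> entire_functions"
  shows "(B ^^ N) (\<lambda>z. c * f z) = (\<lambda>z. c * (B ^^ N) f z)"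
proof (rule entire_eqI)
  show "taylor ((B ^^ N) (\<lambda>z. c * f z)) = taylor (\<lambda>z. c * (B ^^ N) f z)"
    by (intro fps_ext)
       (simp add: taylor_Bpow taylor_cmult entire_intros f Bpow_entire
        shift_coeffs_funpow[OF weight])
qed (intro Bpow_entire entire_intros f)+

lemma Bpow_diff:
  assumes f: "f \<in> entire_functions" and g: "g \<in> entire_functions"
  shows "(B ^^ N) (\<lambda>z. f z - g z) = (\<lambda>z. (B ^^ N) f z - (B ^^ N) g z)"
proof -
  have "(\<lambda>z. (-1) * g z) \<in> entire_functions" by (intro entire_intros g)
  from Bpow_add[OF f this, of N] show ?thesis
    using Bpow_cmult[OF g, of N "-1"] by simp
qed

lemma Bpow_zero: "(B ^^ N) (\<lambda>z. 0) = (\<lambda>z. 0)"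
  using Bpow_cmult[of "\<lambda>z. 0" N 0] by (simp add: entire_intros)

lemma Bpow_sum:
  assumes "finite I" "\<And>i. i \<in> I \<Longrightarrow> f i \<in> entire_functions"
  shows "(B ^^ N) (\<lambda>z. \<Sum>i\<in>I. c i * f i z) = (\<lambda>z. \<Sum>i\<in>I. c i * (B ^^ N) (f i) z)"
  using assms
proof (induction I rule: finite_induct)
  case empty
  then show ?case by (simp add: Bpow_zero)
next
  case (insert i I)
  have "(B ^^ N) (\<lambda>z. c i * f i z + (\<Sum>i\<in>I. c i * f i z))
      = (\<lambda>z. (B ^^ N) (\<lambda>z. c i * f i z) z + (B ^^ N) (\<lambda>z. \<Sum>i\<in>I. c i * f i z) z)"
    using insert.prems by (intro Bpow_add entire_intros entire_sum) auto
  then show ?case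
    using insert by (simp add: Bpow_cmult)
qed

lemma Bpow_poly:
  assumes "\<And>n. coeff Q n = v (n + N) / v n * coeff P (n + N)"
  shows "(B ^^ N) (poly P) = poly Q"
proof (rule entire_eqI)
  show "taylor ((B ^^ N) (poly P)) = taylor (poly Q)"
    by (intro fps_ext)
       (simp add: taylor_Bpow entire_intros taylor_poly shift_coeffs_funpow[OF weight] assms)
qed (intro Bpow_entire entire_intros)+

lemma Bpow_poly_small:
  assumes "degree P < N"
  shows "(B ^^ N) (poly P) = (\<lambda>z. 0)"
  using Bpow_poly[of 0 N P] assms by (auto simp: coeff_eq_0)

text \<open>If the roots \<open>\<bar>w\<^sub>n\<bar>\<^bsup>1/n\<^esup>\<close> were unbounded, the series with coefficients \<open>1 / w\<^sub>n\<close> at the indices \<open>n\<close>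
  where they attain a new record would be entire, but its shift would have infinitely many
  coefficients \<open>1\<close>.\<close>

lemma weight_bound:
  obtains C :: nat where "C \<ge> 1" "\<forall>n. norm (w n) \<le> real C ^ n"
proof -
  \<comment> \<open>\<open>root 0\<close> is 0 by convention; \<open>cpow\<close> survives at
    \<open>n = 0\<close> because both sides are 1 there, by \<open>w 0 = 1\<close>.\<close>
  define c where "c n = root n (norm (w n))" for n
  have cpow: "c n ^ n = norm (w n)" for n
    using weight by (cases "n = 0") (auto simp: c_def weight_def)
  have c_nonneg: "c n \<ge> 0" for n by (simp add: c_def real_root_ge_zero)
  have "\<exists>C. \<forall>n. c n \<le> C"
  proof (rule ccontr)
    assume "\<not> ?thesis"
    then have unb: "\<exists>n. c n > C" for C by (meson not_le)
    define R where "R = {n. \<forall>m<n. c m < c n}"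
    have rec: "\<exists>n\<in>R. c n > C" for C
    proof
      let ?n = "LEAST n. c n > C"
      show n: "c ?n > C" using LeastI_ex[OF unb] .
      have "c m \<le> C" if "m < ?n" for m using not_less_Least[OF that] by simp
      then show "?n \<in> R" unfolding R_def using n by (blast intro: le_less_trans)
    qed
    have rec_inf: "\<exists>n\<in>R. n > M" for M
    proof -
      obtain n where n: "n \<in> R" "c n > (\<Sum>i\<le>M. c i)" using rec by blast
      have "c i \<le> (\<Sum>i\<le>M. c i)" if "i \<le> M" for i
        using that c_nonneg by (intro member_le_sum) auto
      then have "n > M" using n(2) by (meson not_le)
      then show ?thesis using n(1) by blast
    qed
    define F where "F = Abs_fps (\<lambda>n. if n \<in> R then 1 / w n else 0)"
    have "summable (\<lambda>n. fps_nth F n * z ^ n)" for z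
    proof (rule summable_comparison_test[OF _ summable_geometric[of "1/2::real"]])
      \<comment> \<open>Records after \<open>n0\<close> exceed \<open>c n0\<close>, so from there on
        the terms \<open>(norm z / c n) ^ n\<close> are dominated by a geometric series.\<close>
      obtain n0 where n0: "c n0 > 2 * norm z" using unb by blast
      show "\<exists>N. \<forall>n\<ge>N. norm (fps_nth F n * z ^ n) \<le> (1/2) ^ n"
      proof (intro exI[of _ "Suc n0"] allI impI)
        fix n assume "n \<ge> Suc n0"
        show "norm (fps_nth F n * z ^ n) \<le> (1/2) ^ n"
        proof (cases "n \<in> R")
          case True
          then have "c n > c n0" using \<open>n \<ge> Suc n0\<close> by (auto simp: R_def)
          then have cn: "c n > 2 * norm z" using n0 by simp
          then have "c n > 0" using norm_ge_zero[of z] by linarith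
          have "norm (fps_nth F n * z ^ n) = (norm z / c n) ^ n"
            using True by (simp add: F_def norm_mult norm_divide norm_power power_divide cpow)
          also have "\<dots> \<le> (1/2) ^ n"
            using cn \<open>c n > 0\<close> by (intro power_mono) (auto simp: field_simps)
          finally show ?thesis .
        qed (simp add: F_def)
      qed
    qed simp
    then have F: "fps_conv_radius F = \<infinity>"
      unfolding fps_conv_radius_def by (rule conv_radius_inftyI'')
    then have "fps_conv_radius (shift_coeffs w F) = \<infinity>"
      using entire_shift eval_fps_entire[OF F] taylor_eval[OF F]
      unfolding entire_weighted_shift_def by force
    then have "summable (\<lambda>n. fps_nth (shift_coeffs w F) n * 1 ^ n)"
      by (intro summable_fps) auto
    then have "(\<lambda>n. fps_nth (shift_coeffs w F) n) \<longlonglongrightarrow> 0"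
      using summable_LIMSEQ_zero by fastforce
    then obtain M where M: "\<And>n. n \<ge> M \<Longrightarrow> norm (fps_nth (shift_coeffs w F) n) < 1"
      using LIMSEQ_D[of _ 0 1] by fastforce
    obtain n where n: "n \<in> R" "n > M" using rec_inf by blast
    \<comment> \<open>The shift moves the coefficient \<open>1 / w n\<close> from index
      \<open>n\<close> to \<open>n - 1\<close> and multiplies it by \<open>w n\<close>;
      \<open>n > M\<close> keeps \<open>n - 1\<close> in the range where the coefficients should be
      below 1.\<close>
    have "fps_nth (shift_coeffs w F) (n - 1) = 1"
      using n weight by (simp add: shift_coeffs_def F_def weight_def)
    moreover have "M \<le> n - 1" using n(2) by simp
    ultimately show False using M[of "n - 1"] by simp
  qed
  then obtain C where C: "\<And>n. c n \<le> C" by blast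
  obtain C' :: nat where C': "C \<le> real C'" using real_arch_simple by blast
  have "norm (w n) \<le> real (Suc C') ^ n" for n
    unfolding cpow[symmetric] using C[of n] C' by (intro power_mono c_nonneg) simp
  then show ?thesis by (intro that[of "Suc C'"]) auto
qed

text \<open>With \<open>norm (w n) \<le> C ^ n\<close>, Cauchy's estimate on the disc of radius
  \<open>2 * C * q\<close> bounds the Taylor series of \<open>B f\<close> on the disc of radius
  \<open>q\<close> by a geometric series with sum \<open>e\<close>. The same \<open>e\<close> on
  both sides and a constant independent of \<open>q\<close> make the estimate ready for
  iteration.\<close>

lemma B_bounded:
  obtains C :: nat where "C \<ge> 1"
    and "\<forall>f\<in>entire_functions. \<forall>q\<ge>1. \<forall>e. (\<forall>z. norm z \<le> real (C * q) \<longrightarrow> norm (f z) \<le> e) \<longrightarrow>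
           (\<forall>z. norm z \<le> real q \<longrightarrow> norm (B f z) \<le> e)"
proof -
  obtain C :: nat where C: "C \<ge> 1" "\<forall>n. norm (w n) \<le> real C ^ n"
    using weight_bound .
  show ?thesis
  proof (rule that[of "2 * C"]; (intro ballI allI impI)?)
    fix f :: "complex \<Rightarrow> complex" and q :: nat and e :: real and z :: complex
    assume f: "f \<in> entire_functions" and q: "q \<ge> 1" and z: "norm z \<le> real q"
      and "\<forall>z. norm z \<le> real (2 * C * q) \<longrightarrow> norm (f z) \<le> e"
    then have bound: "\<And>z. norm z \<le> real (2 * C * q) \<Longrightarrow> norm (f z) \<le> e" by blast
    have e: "0 \<le> e" by (rule order_trans[OF norm_ge_zero bound[of 0]]) simp
    let ?t = "\<lambda>n. fps_nth (shift_coeffs w (taylor f)) n * z ^ n"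
    have le: "norm (?t n) \<le> e * (1/2) ^ Suc n" for n
    proof -
      have "1 \<le> 2 * C * q" using C(1) q by simp
      from taylor_coeff_bound[OF f this bound]
      have coeff: "norm (fps_nth (taylor f) (Suc n)) \<le> e / real (2 * C * q) ^ Suc n" .
      have "norm (w (Suc n)) \<le> real C ^ Suc n" using C(2) by blast
      then have "norm (?t n) \<le> real C ^ Suc n * (e / real (2 * C * q) ^ Suc n) * real q ^ n"
        unfolding shift_coeffs_def fps_nth_Abs_fps norm_mult norm_power
        by (intro mult_mono power_mono coeff z) (use e in auto)
      also have "\<dots> = e * (1/2) ^ Suc n / real q"
        using C q by (simp add: power_mult_distrib field_simps)
      also have "\<dots> \<le> e * (1/2) ^ Suc n / 1"
        using q e by (intro divide_left_mono) auto
      finally show ?thesis by simp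
    qed
    have sums: "(\<lambda>n. e * (1/2) ^ Suc n) sums e"
      using sums_mult[OF power_half_series, of e] by simp
    have "norm (B f z) = norm (\<Sum>n. ?t n)"
      by (simp add: backward_shift_def eval_fps_def)
    also have "\<dots> \<le> (\<Sum>n. e * (1/2) ^ Suc n)"
      using sums_summable[OF sums] le by (rule norm_suminf_le[rotated])
    also have "\<dots> = e" using sums by (rule sums_unique[symmetric])
    finally show "norm (B f z) \<le> e" .
  qed (use C in auto)
qed

text \<open>Each application of \<open>B\<close> costs a factor \<open>C\<close> in the radius and
  nothing in the bound.\<close>

lemma Bpow_bounded:
  assumes "q \<ge> 1"
  obtains r :: nat where "r \<ge> 1"
    and "\<forall>f\<in>entire_functions. \<forall>e. (\<forall>z. norm z \<le> real r \<longrightarrow> norm (f z) \<le> e) \<longrightarrow>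
           (\<forall>z. norm z \<le> real q \<longrightarrow> norm ((B ^^ N) f z) \<le> e)"
proof -
  obtain C :: nat where C: "C \<ge> 1"
    and bound: "\<forall>f\<in>entire_functions. \<forall>q\<ge>1. \<forall>e. (\<forall>z. norm z \<le> real (C * q) \<longrightarrow> norm (f z) \<le> e) \<longrightarrow>
           (\<forall>z. norm z \<le> real q \<longrightarrow> norm (B f z) \<le> e)"
    using B_bounded .
  have "\<forall>z. norm z \<le> real q \<longrightarrow> norm ((B ^^ N) f z) \<le> e"
    if "f \<in> entire_functions" "\<forall>z. norm z \<le> real (C ^ N * q) \<longrightarrow> norm (f z) \<le> e" for f e
    using that
  proof (induction N arbitrary: f)
    case (Suc N)
    have "1 \<le> C ^ N * q" using C assms by simp
    then have "norm (B f z) \<le> e" if "norm z \<le> real (C ^ N * q)" for z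
      using bound[rule_format, of f "C ^ N * q" e z] Suc.prems that by (simp add: mult.assoc)
    then show ?case
      using Suc.IH[of "B f"] Suc.prems(1) by (simp add: B_entire funpow_Suc_right del: funpow.simps)
  qed auto
  then show ?thesis using C assms by (intro that[of "C ^ N * q"]) (simp, blast)
qed

end

section \<open>Baire category for pairs of entire functions\<close>

text \<open>Completeness of the space of entire functions in the form needed for nested balls: the
  bounds that hold from stage \<open>n\<close> on pass to the limit, so the limit stays in the
  \<open>n\<close>-th closed ball.\<close>

lemma entire_limit:
  assumes F: "\<And>n. F n \<in> entire_functions"
    and close: "\<And>n m z. n \<le> m \<Longrightarrow> norm z \<le> r n \<Longrightarrow> norm (F m z - F n z) \<le> d n"
    and d: "d \<longlonglongrightarrow> 0" and r: "filterlim r at_top sequentially"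
  obtains f where "f \<in> entire_functions" "\<And>n z. norm z \<le> r n \<Longrightarrow> norm (f z - F n z) \<le> d n"
proof -
  have conv: "uniformly_convergent_on (cball 0 R) F" for R
  proof (rule Cauchy_uniformly_convergent, rule uniformly_Cauchy_onI')
    fix e :: real assume "e > 0"
    have "\<forall>\<^sub>F n in sequentially. d n < e \<and> r n \<ge> R"
      using order_tendstoD(2)[OF d \<open>e > 0\<close>] r
      by (auto simp: filterlim_at_top eventually_conj_iff)
    then obtain M where M: "\<And>n. n \<ge> M \<Longrightarrow> d n < e \<and> r n \<ge> R"
      unfolding eventually_sequentially by blast
    show "\<exists>M. \<forall>x\<in>cball 0 R. \<forall>m\<ge>M. \<forall>n>m. dist (F m x) (F n x) < e"
    proof (intro exI[of _ M] ballI allI impI)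
      fix x m n assume "x \<in> cball (0::complex) R" "m \<ge> M" "m < n"
      then have "norm (F n x - F m x) \<le> d m" using M[of m] by (intro close) auto
      then show "dist (F m x) (F n x) < e"
        using M[of m] \<open>m \<ge> M\<close> by (simp add: dist_norm norm_minus_commute)
    qed
  qed
  define f where "f z = lim (\<lambda>n. F n z)" for z
  have ul: "uniform_limit (cball 0 R) F f sequentially" for R
    using conv[of R] unfolding f_def uniformly_convergent_uniform_limit_iff .
  have lim: "(\<lambda>n. F n z) \<longlonglongrightarrow> f z" for z
    using ul[of "norm z"] by (rule tendsto_uniform_limitI) simp
  have "f holomorphic_on UNIV"
  proof (rule holomorphic_uniform_sequence)
    show "F n holomorphic_on UNIV" for n using F by (rule entire_functionsD)
    fix x :: complex
    have "cball x 1 \<subseteq> cball 0 (norm x + 1)"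
      by (auto simp: dist_norm) (smt (verit) norm_minus_commute norm_triangle_sub)
    then show "\<exists>d>0. cball x d \<subseteq> UNIV \<and> uniform_limit (cball x d) F f sequentially"
      using uniform_limit_on_subset[OF ul] by (intro exI[of _ 1]) auto
  qed simp
  moreover have "norm (f z - F n z) \<le> d n" if "norm z \<le> r n" for n z
  proof (rule tendsto_upperbound)
    show "(\<lambda>m. norm (F m z - F n z)) \<longlonglongrightarrow> norm (f z - F n z)"
      by (intro tendsto_intros lim)
    show "\<forall>\<^sub>F m in sequentially. norm (F m z - F n z) \<le> d n"
      using close that by (auto simp: eventually_sequentially)
  qed simp
  ultimately show ?thesis by (intro that entire_functionsI)
qed

text \<open>A closed ball around \<open>(f, g)\<close> in the product space: the non-strict
  inequalities survive limits, as the nested construction requires.\<close>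

definition near_pair :: "real \<Rightarrow> real \<Rightarrow> (complex \<Rightarrow> complex) \<Rightarrow> (complex \<Rightarrow> complex) \<Rightarrow>
    (complex \<Rightarrow> complex) \<Rightarrow> (complex \<Rightarrow> complex) \<Rightarrow> bool" where
  "near_pair r d f g f' g' \<longleftrightarrow>
     (\<forall>z. norm z \<le> r \<longrightarrow> norm (f' z - f z) \<le> d \<and> norm (g' z - g z) \<le> d)"

lemma near_pair_mono:
  "near_pair r d f g f' g' \<Longrightarrow> r' \<le> r \<Longrightarrow> d \<le> d' \<Longrightarrow> near_pair r' d' f g f' g'"
  unfolding near_pair_def by (meson order_trans)

lemma near_pair_trans:
  assumes "near_pair r d f g f' g'" "near_pair r d' f' g' f'' g''"
  shows "near_pair r (d + d') f g f'' g''"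
  unfolding near_pair_def
proof (intro allI impI conjI)
  fix z :: complex assume z: "norm z \<le> r"
  have "norm (f'' z - f z) \<le> norm (f' z - f z) + norm (f'' z - f' z)"
    using norm_triangle_ineq[of "f' z - f z" "f'' z - f' z"] by simp
  then show "norm (f'' z - f z) \<le> d + d'"
    using assms z unfolding near_pair_def by fastforce
  have "norm (g'' z - g z) \<le> norm (g' z - g z) + norm (g'' z - g' z)"
    using norm_triangle_ineq[of "g' z - g z" "g'' z - g' z"] by simp
  then show "norm (g'' z - g z) \<le> d + d'"
    using assms z unfolding near_pair_def by fastforce
qed

text \<open>The Baire category argument in \<open>H(\<complex>)\<^sup>2\<close>, using only that polynomials approximate
  the members of the given open sets.\<close>

lemma baire_entire_pairs:
  fixes G :: "'i \<Rightarrow> (complex \<Rightarrow> complex) \<Rightarrow> (complex \<Rightarrow> complex) \<Rightarrow> bool"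
  assumes J: "countable J"
    and dense: "\<And>i P Q r d. i \<in> J \<Longrightarrow> d > 0 \<Longrightarrow>
      \<exists>P' Q' r' d'. near_pair r d (poly P) (poly Q) (poly P') (poly Q') \<and> d' > 0 \<and>
        (\<forall>f\<in>entire_functions. \<forall>g\<in>entire_functions.
           near_pair r' d' (poly P') (poly Q') f g \<longrightarrow> G i f g)"
  obtains f g where "f \<in> entire_functions" "g \<in> entire_functions" "\<And>i. i \<in> J \<Longrightarrow> G i f g"
proof (cases "J = {}")
  case True
  then show ?thesis using that entire_intros(1) by blast
next
  case False
  define ix where "ix = from_nat_into J"
  have ix: "ix n \<in> J" for n using False by (simp add: ix_def from_nat_into)
  have ix_surj: "\<exists>n. ix n = i" if "i \<in> J" for i
    using from_nat_into_surj[OF J that] by (simp add: ix_def)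
  \<comment> \<open>A state \<open>(P, Q, r, d)\<close> encodes a closed ball with polynomial
    centre. \<open>inv\<close> sends the radii \<open>r\<close> to infinity and the tolerances
    \<open>d\<close> to 0; \<open>step\<close> nests the balls and puts the next one inside the next
    set \<open>G (ix n)\<close>.\<close>
  define nr where "nr s f g = (case s of (P, Q, r, d) \<Rightarrow> near_pair r d (poly P) (poly Q) f g)"
    for s :: "complex poly \<times> complex poly \<times> real \<times> real" and f g
  define inv where "inv n s = (case s of (P, Q, r, d) \<Rightarrow> r \<ge> real n \<and> 0 < d \<and> d \<le> (1/2) ^ n)"
    for n and s :: "complex poly \<times> complex poly \<times> real \<times> real"
  define step where "step n s s' \<longleftrightarrow> (\<forall>f g. nr s' f g \<longrightarrow> nr s f g) \<and>
      (\<forall>f\<in>entire_functions. \<forall>g\<in>entire_functions. nr s' f g \<longrightarrow> G (ix n) f g)" for n s s'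
  have "\<exists>S. \<forall>n. inv n (S n) \<and> step n (S n) (S (Suc n))"
  proof (rule dependent_nat_choice)
    show "\<exists>s. inv 0 s" by (auto simp: inv_def intro!: exI[of _ 0] exI[of _ 1])
    fix s n assume "inv n s"
    obtain P Q r d where s: "s = (P, Q, r, d)" by (cases s)
    have d: "d > 0" using \<open>inv n s\<close> by (simp add: inv_def s)
    \<comment> \<open>Half of the tolerance pays for moving the centre, the other half for the new
      ball around it.\<close>
    obtain P' Q' r' d' where near: "near_pair r (d/2) (poly P) (poly Q) (poly P') (poly Q')"
      and d': "d' > 0" and G: "\<forall>f\<in>entire_functions. \<forall>g\<in>entire_functions.
           near_pair r' d' (poly P') (poly Q') f g \<longrightarrow> G (ix n) f g"
      using dense[OF ix, of "d/2" r P Q n] d by auto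
    define s' where "s' = (P', Q', max (max r r') (real (Suc n)), min (min (d/2) d') ((1/2) ^ Suc n))"
    have "nr s f g" if "nr s' f g" for f g
    proof -
      have "near_pair r (d/2) (poly P') (poly Q') f g"
        using that unfolding nr_def s'_def prod.case by (rule near_pair_mono) auto
      from near_pair_trans[OF near this] show ?thesis by (simp add: nr_def s)
    qed
    moreover have "G (ix n) f g" if "nr s' f g" "f \<in> entire_functions" "g \<in> entire_functions" for f g
    proof -
      have "near_pair r' d' (poly P') (poly Q') f g"
        using that(1) unfolding nr_def s'_def prod.case by (rule near_pair_mono) auto
      then show ?thesis using G that by blast
    qed
    moreover have "inv (Suc n) s'" using d d' by (simp add: inv_def s'_def)
    ultimately show "\<exists>s'. inv (Suc n) s' \<and> step n s s'" unfolding step_def by blast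
  qed
  then obtain S where S: "\<And>n. inv n (S n)" "\<And>n. step n (S n) (S (Suc n))" by blast
  define P Q r d where "P n = fst (S n)" and "Q n = fst (snd (S n))"
    and "r n = fst (snd (snd (S n)))" and "d n = snd (snd (snd (S n)))" for n
  have Seq: "S n = (P n, Q n, r n, d n)" for n by (simp add: P_def Q_def r_def d_def)
  have inv: "r n \<ge> real n" "d n > 0" "d n \<le> (1/2) ^ n" for n
    using S(1)[of n] by (auto simp: inv_def Seq)
  have nest: "nr (S m) f g \<Longrightarrow> nr (S n) f g" if "n \<le> m" for n m f g
    using that by (induction m rule: dec_induct) (use S(2) in \<open>auto simp: step_def\<close>)
  \<comment> \<open>The centre of ball \<open>m\<close> lies in that ball, hence in every earlier
    one; this is the Cauchy condition for \<open>entire_limit\<close>.\<close>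
  have self: "near_pair (r n) (d n) (poly (P n)) (poly (Q n)) (poly (P m)) (poly (Q m))"
    if "n \<le> m" for n m
  proof -
    have "nr (S m) (poly (P m)) (poly (Q m))"
      using inv(2)[of m] by (simp add: nr_def Seq near_pair_def)
    from nest[OF that this] show ?thesis by (simp add: nr_def Seq)
  qed
  have dlim: "d \<longlonglongrightarrow> 0"
    by (rule tendsto_sandwich[OF _ _ tendsto_const LIMSEQ_realpow_zero[of "1/2"]])
       (use inv in \<open>auto intro!: always_eventually less_imp_le\<close>)
  have rlim: "filterlim r at_top sequentially"
    using filterlim_real_sequentially by (rule filterlim_at_top_mono) (simp add: inv)
  obtain f where f: "f \<in> entire_functions"
    "\<And>n z. norm z \<le> r n \<Longrightarrow> norm (f z - poly (P n) z) \<le> d n"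
    using self unfolding near_pair_def
    by (rule_tac entire_limit[of "\<lambda>n. poly (P n)" r d, OF entire_intros(6) _ dlim rlim]) auto
  obtain g where g: "g \<in> entire_functions"
    "\<And>n z. norm z \<le> r n \<Longrightarrow> norm (g z - poly (Q n) z) \<le> d n"
    using self unfolding near_pair_def
    by (rule_tac entire_limit[of "\<lambda>n. poly (Q n)" r d, OF entire_intros(6) _ dlim rlim]) auto
  have "nr (S n) f g" for n using f g by (simp add: nr_def Seq near_pair_def)
  then have "G (ix n) f g" for n using S(2)[of n] f(1) g(1) unfolding step_def by blast
  then show ?thesis using ix_surj f(1) g(1) that by metis
qed

text \<open>On the disc both functions take values in a compact set, and
  \<open>(x, y) \<mapsto> x ^ a * y ^ b\<close> is uniformly continuous on a slightly larger
  one.\<close>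

lemma monomial_near:
  assumes f: "f \<in> entire_functions" and g: "g \<in> entire_functions" and e: "e > 0"
  obtains d where "d > 0"
    "\<And>f' g'. near_pair r d f g f' g' \<Longrightarrow>
       \<forall>z. norm z \<le> r \<longrightarrow> norm (f' z ^ a * g' z ^ b - f z ^ a * g z ^ b) \<le> e"
proof -
  have "bounded (f ` cball 0 r)" "bounded (g ` cball 0 r)"
    using f g by (intro compact_imp_bounded compact_continuous_image
        holomorphic_on_imp_continuous_on entire_functionsD; simp)+
  then obtain M1 M2 where M: "\<forall>x\<in>f ` cball 0 r. norm x \<le> M1" "\<forall>x\<in>g ` cball 0 r. norm x \<le> M2"
    unfolding bounded_iff by metis
  define K where "K = cball (0::complex) (M1 + 1) \<times> cball (0::complex) (M2 + 1)"
  have "compact K" unfolding K_def by (intro compact_Times compact_cball)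
  moreover have "continuous_on K (\<lambda>p. fst p ^ a * snd p ^ b)"
    by (intro continuous_intros)
  ultimately have "uniformly_continuous_on K (\<lambda>p. fst p ^ a * snd p ^ b)"
    by (rule compact_uniformly_continuous[rotated])
  then obtain d where d: "d > 0"
    "\<And>p p'. p \<in> K \<Longrightarrow> p' \<in> K \<Longrightarrow> dist p' p < d \<Longrightarrow>
       dist (fst p' ^ a * snd p' ^ b) (fst p ^ a * snd p ^ b) < e"
    unfolding uniformly_continuous_on_def using e by metis
  show ?thesis
  \<comment> \<open>The bound 1 keeps the perturbed values inside \<open>K\<close>; two errors of
    \<open>d / 3\<close> add up to less than \<open>d\<close>.\<close>
  proof (rule that[of "min 1 (d / 3)"])
    fix f' g' assume near: "near_pair r (min 1 (d / 3)) f g f' g'"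
    show "\<forall>z. norm z \<le> r \<longrightarrow> norm (f' z ^ a * g' z ^ b - f z ^ a * g z ^ b) \<le> e"
    proof (intro allI impI)
      fix z :: complex assume z: "norm z \<le> r"
      have n: "norm (f' z - f z) \<le> 1" "norm (g' z - g z) \<le> 1"
        "norm (f' z - f z) \<le> d/3" "norm (g' z - g z) \<le> d/3"
        using near z unfolding near_pair_def by auto
      have M': "norm (f z) \<le> M1" "norm (g z) \<le> M2" using M z by auto
      have "norm (f' z) \<le> M1 + 1" "norm (g' z) \<le> M2 + 1"
        using n M' norm_triangle_sub[of "f' z" "f z"] norm_triangle_sub[of "g' z" "g z"] by linarith+
      then have K: "(f' z, g' z) \<in> K" "(f z, g z) \<in> K" using M' by (auto simp: K_def)
      have "dist (f' z, g' z) (f z, g z) \<le> norm (f' z - f z) + norm (g' z - g z)"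
        by (simp add: dist_norm norm_Pair sqrt_sum_squares_le_sum)
      also have "\<dots> < d" using n d(1) by linarith
      finally show "norm (f' z ^ a * g' z ^ b - f z ^ a * g z ^ b) \<le> e"
        using d(2)[OF K(2,1)] by (simp add: dist_norm)
    qed
  qed (use d in auto)
qed

context entire_shift
begin

text \<open>For fixed \<open>N\<close>, continuity of \<open>B ^^ N\<close> and of the monomial
  combine. This turns what is achieved exactly at polynomial pairs into a condition that holds on a
  whole ball around them.\<close>

lemma Bpow_monomial_near:
  assumes f: "f \<in> entire_functions" and g: "g \<in> entire_functions" and e: "e > 0" and q: "q \<ge> 1"
  obtains r d where "d > 0"
    "\<forall>f'\<in>entire_functions. \<forall>g'\<in>entire_functions. near_pair r d f g f' g' \<longrightarrow>
       (\<forall>z. norm z \<le> real q \<longrightarrow> norm ((B ^^ N) (\<lambda>z. f' z ^ a * g' z ^ b) z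
          - (B ^^ N) (\<lambda>z. f z ^ a * g z ^ b) z) \<le> e)"
proof -
  obtain r :: nat where r: "\<forall>h\<in>entire_functions. \<forall>e. (\<forall>z. norm z \<le> real r \<longrightarrow> norm (h z) \<le> e) \<longrightarrow>
           (\<forall>z. norm z \<le> real q \<longrightarrow> norm ((B ^^ N) h z) \<le> e)"
    using Bpow_bounded[OF q] by metis
  obtain d where d: "d > 0" "\<And>f' g'. near_pair (real r) d f g f' g' \<Longrightarrow>
       \<forall>z. norm z \<le> real r \<longrightarrow> norm (f' z ^ a * g' z ^ b - f z ^ a * g z ^ b) \<le> e"
    using monomial_near[OF f g e] by metis
  show ?thesis
  proof (rule that[of d r]; (intro ballI impI)?)
    fix f' g' assume f': "f' \<in> entire_functions" and g': "g' \<in> entire_functions"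
      and near: "near_pair (real r) d f g f' g'"
    have "(\<lambda>z. f' z ^ a * g' z ^ b - f z ^ a * g z ^ b) \<in> entire_functions"
      by (intro entire_intros f g f' g')
    from r[rule_format, OF this, of e] d(2)[OF near]
    have "\<forall>z. norm z \<le> real q \<longrightarrow>
        norm ((B ^^ N) (\<lambda>z. f' z ^ a * g' z ^ b - f z ^ a * g z ^ b) z) \<le> e" by blast
    then show "\<forall>z. norm z \<le> real q \<longrightarrow> norm ((B ^^ N) (\<lambda>z. f' z ^ a * g' z ^ b) z
          - (B ^^ N) (\<lambda>z. f z ^ a * g z ^ b) z) \<le> e"
      by (subst (asm) Bpow_diff) (auto intro!: entire_intros f g f' g')
  qed (rule d(1))
qed

lemma Bpow_monomials_near:
  assumes "finite I" and f: "f \<in> entire_functions" and g: "g \<in> entire_functions"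
    and e: "e > 0" and q: "q \<ge> 1"
  shows "\<exists>r d. d > 0 \<and> (\<forall>f'\<in>entire_functions. \<forall>g'\<in>entire_functions. near_pair r d f g f' g' \<longrightarrow>
       (\<forall>(a, b)\<in>I. \<forall>z. norm z \<le> real q \<longrightarrow> norm ((B ^^ N) (\<lambda>z. f' z ^ a * g' z ^ b) z
          - (B ^^ N) (\<lambda>z. f z ^ a * g z ^ b) z) \<le> e))"
  using assms(1)
proof (induction I rule: finite_induct)
  case empty
  then show ?case by (auto intro!: exI[of _ "1::real"])
next
  case (insert p I)
  obtain a b where p: "p = (a, b)" by (cases p)
  from insert.IH obtain r d where rd: "d > 0"
    "\<And>f' g'. f' \<in> entire_functions \<Longrightarrow> g' \<in> entire_functions \<Longrightarrow> near_pair r d f g f' g' \<Longrightarrow>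
       \<forall>(a, b)\<in>I. \<forall>z. norm z \<le> real q \<longrightarrow> norm ((B ^^ N) (\<lambda>z. f' z ^ a * g' z ^ b) z
          - (B ^^ N) (\<lambda>z. f z ^ a * g z ^ b) z) \<le> e" by blast
  obtain r' d' where rd': "d' > 0"
    "\<forall>f'\<in>entire_functions. \<forall>g'\<in>entire_functions. near_pair r' d' f g f' g' \<longrightarrow>
       (\<forall>z. norm z \<le> real q \<longrightarrow> norm ((B ^^ N) (\<lambda>z. f' z ^ a * g' z ^ b) z
          - (B ^^ N) (\<lambda>z. f z ^ a * g z ^ b) z) \<le> e)"
    using Bpow_monomial_near[OF f g e q] .
  let ?close = "\<lambda>f' g' (a, b). \<forall>z. norm z \<le> real q \<longrightarrow> norm ((B ^^ N) (\<lambda>z. f' z ^ a * g' z ^ b) z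
          - (B ^^ N) (\<lambda>z. f z ^ a * g z ^ b) z) \<le> e"
  have "\<forall>x\<in>insert p I. ?close f' g' x"
    if *: "f' \<in> entire_functions" "g' \<in> entire_functions"
      "near_pair (max r r') (min d d') f g f' g'" for f' g'
  proof -
    have "near_pair r d f g f' g'" "near_pair r' d' f g f' g'"
      by (rule near_pair_mono[OF *(3)]; simp)+
    with * have "\<forall>x\<in>I. ?close f' g' x" "?close f' g' p"
      using rd(2) rd'(2) unfolding p prod.case by blast+
    then show ?thesis by simp
  qed
  moreover have "min d d' > 0" using rd(1) rd'(1) by simp
  ultimately show ?case by blast
qed

end

section \<open>Perturbing pairs of polynomials\<close>

text \<open>In the binomial expansion every factor \<open>h\<close> in place of \<open>x\<close>
  lowers the degree bound by \<open>e\<close>, and \<open>R\<close> collects the terms with at least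
  two such factors. The condition \<open>2 * e \<le> n\<close> keeps the natural-number subtractions
  from truncating.\<close>

lemma power_add_linear_remainder:
  fixes x h :: "'a::comm_ring_1 poly"
  assumes x: "degree x \<le> n" and h: "degree h \<le> n - e" and e: "2 * e \<le> n"
  obtains R where "(x + h) ^ Suc a = x ^ Suc a + of_nat (Suc a) * x ^ a * h + R"
    and "degree R \<le> Suc a * n - 2 * e"
proof -
  have "\<exists>R. (x + h) ^ Suc a = x ^ Suc a + of_nat (Suc a) * x ^ a * h + R
      \<and> degree R \<le> Suc a * n - 2 * e"
  proof (induction a)
    case 0
    show ?case by (intro exI[of _ 0]) simp
  next
    case (Suc a)
    then obtain R where R: "(x + h) ^ Suc a = x ^ Suc a + of_nat (Suc a) * x ^ a * h + R"
      "degree R \<le> Suc a * n - 2 * e" by blast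
    define R' where "R' = of_nat (Suc a) * (x ^ a * (h * h)) + (x + h) * R"
    have "(x + h) ^ Suc (Suc a) = (x + h) * (x ^ Suc a + of_nat (Suc a) * x ^ a * h + R)"
      by (simp only: power_Suc[of _ "Suc a"] R(1))
    also have "\<dots> = x ^ Suc (Suc a) + of_nat (Suc (Suc a)) * x ^ Suc a * h + R'"
      by (simp add: R'_def algebra_simps)
    finally have eq: "(x + h) ^ Suc (Suc a) = x ^ Suc (Suc a) + of_nat (Suc (Suc a)) * x ^ Suc a * h + R'" .
    have "degree (x ^ a * (h * h)) \<le> a * n + ((n - e) + (n - e))"
      by (intro order_trans[OF degree_mult_le] add_mono h)
         (rule order_trans[OF degree_power_le], use x in \<open>simp add: mult.commute\<close>)
    also have "\<dots> = Suc (Suc a) * n - 2 * e" using e by simp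
    finally have 1: "degree (of_nat (Suc a) * (x ^ a * (h * h))) \<le> Suc (Suc a) * n - 2 * e"
      by (intro order_trans[OF degree_mult_le]) (simp add: degree_of_nat del: of_nat_Suc)
    have "degree ((x + h) * R) \<le> n + (Suc a * n - 2 * e)"
      by (intro order_trans[OF degree_mult_le] add_mono R degree_add_le x)
         (use h in simp)
    also have "\<dots> = Suc (Suc a) * n - 2 * e" using e by simp
    finally have 2: "degree ((x + h) * R) \<le> Suc (Suc a) * n - 2 * e" .
    show ?case using eq degree_add_le[OF 1 2] unfolding R'_def by blast
  qed
  then show ?thesis using that by blast
qed

text \<open>\<open>R\<close> collects the terms with at least one factor \<open>q\<close>, each of
  which trades degree \<open>n\<close> for \<open>s\<close>. The additive form of the bound avoids
  truncated subtraction, and \<open>R = 0\<close> covers \<open>b = 0\<close>.\<close>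

lemma power_add_remainder:
  fixes x q :: "'a::comm_ring_1 poly"
  assumes x: "degree x \<le> n" and q: "degree q \<le> s" and s: "s \<le> n"
  obtains R where "(q + x) ^ b = x ^ b + R" and "R = 0 \<or> degree R + n \<le> b * n + s"
proof -
  have "\<exists>R. (q + x) ^ b = x ^ b + R \<and> (R = 0 \<or> degree R + n \<le> b * n + s)"
  proof (induction b)
    case 0
    show ?case by (intro exI[of _ 0]) simp
  next
    case (Suc b)
    then obtain R where R: "(q + x) ^ b = x ^ b + R" "R = 0 \<or> degree R + n \<le> b * n + s" by blast
    have eq: "(q + x) ^ Suc b = x ^ Suc b + (q * x ^ b + (q + x) * R)"
      by (simp add: R(1) algebra_simps)
    have "degree (q * x ^ b) \<le> s + b * n"
      by (intro order_trans[OF degree_mult_le] add_mono q)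
         (rule order_trans[OF degree_power_le], use x in \<open>simp add: mult.commute\<close>)
    moreover have "degree ((q + x) * R) \<le> s + b * n"
    proof (cases "R = 0")
      case False
      have "degree ((q + x) * R) \<le> n + degree R"
        by (intro order_trans[OF degree_mult_le] add_mono degree_add_le x) (use q s in auto)
      then show ?thesis using R(2) False by simp
    qed simp
    ultimately have "degree (q * x ^ b + (q + x) * R) \<le> s + b * n" by (rule degree_add_le)
    then show ?case using eq by (intro exI[of _ "q * x ^ b + (q + x) * R"]) simp
  qed
  then show ?thesis using that by blast
qed

text \<open>The form in which mixing enters the construction; for these shifts the two are
  equivalent, by \<open>mixing_imp_growing\<close> and \<open>growing_imp_mixing\<close>.\<close>

locale growing_entire_shift = entire_shift +
  assumes growth: "\<And>R. \<forall>\<^sub>F n in sequentially. R ^ n \<le> norm (weight_prod w n)"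
begin

text \<open>The quotient of the two products consists of \<open>j\<close> weights with index at most
  \<open>K\<close>, each bounded by \<open>C ^ K\<close>. The exponent \<open>K * d\<close> makes
  the bound uniform in \<open>j\<close>.\<close>

lemma weight_prod_ratio:
  assumes C: "C \<ge> 1" "\<forall>n. norm (w n) \<le> real C ^ n" and j: "j \<le> d" "d \<le> K"
  shows "norm (v K) \<le> real C ^ (K * d) * norm (v (K - j))"
proof -
  have *: "norm (v K) \<le> real C ^ (K * j) * norm (v (K - j))" if "j \<le> K" for j
    using that
  proof (induction j)
    case (Suc j)
    have "v (K - j) = w (K - j) * v (K - Suc j)"
      using weight_prod_Suc[of w "K - Suc j"] Suc.prems by (simp add: Suc_diff_Suc)
    then have "norm (v (K - j)) \<le> real C ^ (K - j) * norm (v (K - Suc j))"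
      using C(2) by (auto simp: norm_mult intro!: mult_right_mono)
    also have "\<dots> \<le> real C ^ K * norm (v (K - Suc j))"
      using C(1) by (intro mult_right_mono power_increasing) auto
    finally have "real C ^ (K * j) * norm (v (K - j))
        \<le> real C ^ (K * j) * (real C ^ K * norm (v (K - Suc j)))"
      by (intro mult_left_mono) auto
    then show ?case using Suc by (simp add: power_add mult_ac)
  qed simp
  have "norm (v K) \<le> real C ^ (K * j) * norm (v (K - j))" using * j by simp
  also have "\<dots> \<le> real C ^ (K * d) * norm (v (K - j))"
    using C(1) j by (intro mult_right_mono power_increasing) auto
  finally show ?thesis .
qed

text \<open>The perturbations are \<open>\<Sum>\<^sub>i b\<^sub>i z\<^bsup>m-d+i\<^esup> + (\<eta> z)\<^sup>m\<close> and \<open>(\<eta> z)\<^bsup>L m\<^esup>\<close>, where \<open>\<eta>\<close> is the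
  \<open>K\<close>-th root of \<open>1 / \<bar>v\<^sub>K\<bar>\<close> for \<open>K = (a + b L) m\<close>. With \<open>N = K - d\<close>, the coefficients of \<open>f\<^sup>a g\<^sup>b\<close>
  from index \<open>N\<close> on are those of \<open>a (\<Sum>\<^sub>i b\<^sub>i z\<^bsup>m-d+i\<^esup>) (\<eta> z)\<^bsup>K-m\<^esup> + (\<eta> z)\<^bsup>K\<^esup>\<close>, and the monomials
  that are smaller in the order of the statement have degree less than \<open>N\<close>. The factor
  \<open>\<eta>\<^sup>m\<close> dominates the ratios \<open>v\<^sub>K / v\<^bsub>N+i\<^esub>\<close>, which makes the \<open>b\<^sub>i\<close> small.\<close>

lemma monomial_perturbation:
  assumes delta: "\<delta> > 0" and a: "a \<ge> 1" and k: "k \<ge> 1"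
  obtains P' Q' N where "near_pair r \<delta> (poly P) (poly Q) (poly P') (poly Q')"
    and "\<And>z. norm z \<le> real k \<Longrightarrow> norm ((B ^^ N) (poly (P' ^ a * Q' ^ b)) z - poly y z) \<le> 1 / (2 * real k)"
    and "\<And>a' b'. a' \<le> k \<Longrightarrow> b' < b \<or> b' = b \<and> a' < a \<Longrightarrow> (B ^^ N) (poly (P' ^ a' * Q' ^ b')) = (\<lambda>z. 0)"
proof -
  obtain a0 where a0: "a = Suc a0" using a by (cases a) auto
  define l where "l = degree y"
  \<comment> \<open>With weights 1 and \<open>L = k + 1\<close> for the two exponents, first
    exponents up to \<open>k\<close> never outweigh one unit of the second.\<close>
  define L where "L = Suc k"
  define E where "E = a + b * L"
  define s where "s = max (degree P) (degree Q)"
  define W where "W = (\<Sum>i\<le>l. norm (coeff y i * v i))"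
  define \<rho> where "\<rho> = max r 1"
  \<comment> \<open>The first condition makes the image of the top monomial small on the disc of
    radius \<open>k\<close>; the second gives \<open>2 * (d - l) > d\<close>, which pushes the
    quadratic terms below degree \<open>N\<close>.\<close>
  have "\<forall>\<^sub>F d in sequentially. (2 * real k * real k) ^ d \<le> norm (v d) \<and> d \<ge> Suc (2 * l)"
    by (intro eventually_conj growth eventually_ge_at_top)
  then obtain d where d: "(2 * real k * real k) ^ d \<le> norm (v d)" "d > 2 * l"
    by (auto simp: eventually_sequentially)
  obtain C :: nat where C: "C \<ge> 1" "\<forall>n. norm (w n) \<le> real C ^ n" using weight_bound .
  define R where "R = 2 * \<rho> * real C ^ (E * d)"
  have \<rho>: "\<rho> \<ge> 1" by (simp add: \<rho>_def)
  have Cp: "real C ^ n \<ge> 1" for n using C(1) by simp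
  have E: "E \<ge> 1" using a by (simp add: E_def)
  have "(\<lambda>m. (1/2) ^ m * W) \<longlonglongrightarrow> 0" "(\<lambda>m. (1/2::real) ^ m) \<longlonglongrightarrow> 0"
    by (intro tendsto_mult_left_zero LIMSEQ_realpow_zero; simp)+
  then have ev: "\<forall>\<^sub>F m in sequentially. (1/2) ^ m * W < \<delta>/2" "\<forall>\<^sub>F m in sequentially. (1/2) ^ m < \<delta>/2"
    using delta by (auto dest: order_tendstoD(2)[of _ _ _ "\<delta>/2"])
  obtain n0 where n0: "\<And>n. n \<ge> n0 \<Longrightarrow> R ^ n \<le> norm (v n)"
    using growth[of R] by (auto simp: eventually_sequentially)
  \<comment> \<open>The first two conditions make the perturbations small, the next two keep the
    remainders below degree \<open>N\<close>, and the last makes \<open>K \<ge> n0\<close>.\<close>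
  have "\<forall>\<^sub>F m in sequentially. (1/2) ^ m * W < \<delta>/2 \<and> (1/2) ^ m < \<delta>/2 \<and>
      m \<ge> Suc (2 * d) \<and> m \<ge> Suc (s + d) \<and> m \<ge> n0"
    by (intro eventually_conj ev eventually_ge_at_top)
  then obtain m where m: "(1/2) ^ m * W < \<delta>/2" "(1/2) ^ m < \<delta>/2" "m > 2 * d" "m > s + d" "m \<ge> n0"
    by (auto simp: eventually_sequentially)
  define K where "K = E * m"
  define N where "N = K - d"
  have Km: "K \<ge> m" using E by (simp add: K_def)
  have NK: "N + d = K" using Km m by (simp add: N_def)
  define \<eta> where "\<eta> = root K (1 / norm (v K))"
  have K0: "K > 0" using Km m by simp
  have \<eta>0: "\<eta> > 0" by (simp add: \<eta>_def K0)
  have \<eta>K: "\<eta> ^ K = 1 / norm (v K)" by (simp add: \<eta>_def K0)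
  have "(\<eta> * R) ^ K \<le> 1"
    using n0[of K] Km m by (simp add: power_mult_distrib \<eta>K divide_le_eq_1)
  moreover have "R > 0" using \<rho> Cp[of "E * d"] unfolding R_def by (intro mult_pos_pos) linarith+
  ultimately have "\<eta> * R \<le> 1" using \<eta>0 K0 by (simp add: power_le_one_iff)
  then have \<eta>: "\<eta> * \<rho> * real C ^ (E * d) \<le> 1/2" by (simp add: R_def)
  have \<eta>\<rho>: "\<eta> * \<rho> \<le> 1/2"
  proof -
    have "\<eta> * \<rho> * 1 \<le> \<eta> * \<rho> * real C ^ (E * d)"
      using \<eta>0 \<rho> Cp by (intro mult_left_mono) auto
    then show ?thesis using \<eta> by simp
  qed
  define X where "X = monom (complex_of_real \<eta> ^ m) m"
  \<comment> \<open>These are the \<open>b_i\<close> of the description above. They are chosen such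
    that \<open>B ^^ N\<close> maps the cross term \<open>of_nat a * X ^ (a0 + L * b) * H\<close>
    exactly to \<open>y\<close>; see \<open>XH\<close>.\<close>
  define c where "c i = coeff y i * v i / (of_nat a * of_real \<eta> ^ (K - m) * v (N + i))" for i
  define H where "H = (\<Sum>i\<le>l. monom (c i) (m - d + i))"
  define P' where "P' = P + H + X"
  define Q' where "Q' = Q + X ^ L"
  have Xpow: "X ^ j = monom (of_real \<eta> ^ (m * j)) (m * j)" for j
    by (simp add: X_def monom_power power_mult)
  have degX: "degree X \<le> m" by (simp add: X_def degree_monom_le)
  have degXj: "degree (X ^ j) \<le> m * j" for j
    by (simp add: Xpow degree_monom_le)
  have degH: "degree H \<le> m - (d - l)"
    unfolding H_def using m d by (intro degree_sum_le) (auto intro!: order_trans[OF degree_monom_le])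
  have degP: "degree P \<le> s" "degree Q \<le> s" by (auto simp: s_def)
  have degPH: "degree (P + H) \<le> m - (d - l)"
    by (intro degree_add_le degH) (use degP m in auto)
  have degP': "degree P' \<le> m"
    unfolding P'_def by (rule degree_add_le[OF _ degX]) (use degPH in simp)
  have degQ': "degree Q' \<le> L * m"
    unfolding Q'_def using degP m degXj[of L]
    by (intro degree_add_le) (auto simp: L_def mult.commute)
  have KE: "K - m = m * (a0 + L * b)" by (simp add: K_def E_def a0 algebra_simps)

  obtain S where S: "Q' ^ b = (X ^ L) ^ b + S" "S = 0 \<or> degree S + L * m \<le> b * (L * m) + s"
  proof (rule power_add_remainder[of "X ^ L" "L * m" Q s b])
    show "degree (X ^ L) \<le> L * m" using degXj[of L] by (simp add: mult.commute)
    show "s \<le> L * m" using m by (simp add: L_def)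
  qed (use degP in \<open>auto simp: Q'_def\<close>)
  obtain T where T: "(X + (P + H)) ^ Suc a0 = X ^ Suc a0 + of_nat (Suc a0) * X ^ a0 * (P + H) + T"
    "degree T \<le> Suc a0 * m - 2 * (d - l)"
    by (rule power_add_linear_remainder[OF degX degPH]) (use m in auto)
  have XH: "of_nat a * X ^ (a0 + L * b) * H = (\<Sum>i\<le>l. monom (coeff y i * v i / v (N + i)) (N + i))"
  proof -
    have "of_nat a * X ^ (a0 + L * b) * monom (c i) (m - d + i)
        = monom (coeff y i * v i / v (N + i)) (N + i)" for i
    proof -
      have "K - m + (m - d + i) = N + i" using Km m by (simp add: N_def)
      then have "monom (coeff y i * v i / v (N + i)) (N + i)
          = monom (coeff y i * v i / v (N + i)) (K - m + (m - d + i))" by (simp only:)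
      also have "\<dots> = of_nat a * X ^ (a0 + L * b) * monom (c i) (m - d + i)"
        using \<eta>0 a by (simp add: Xpow KE[symmetric] mult_monom c_def of_nat_poly smult_monom)
      finally show ?thesis by simp
    qed
    then show ?thesis by (simp add: H_def sum_distrib_left)
  qed
  \<comment> \<open>The summands stay below degree \<open>K\<close> by more than \<open>d\<close>:
    using \<open>P\<close> in the linear term costs \<open>m - s\<close>, the quadratic terms cost
    \<open>2 * (d - l)\<close>, and a factor \<open>Q\<close> in \<open>Q' ^ b\<close> costs
    \<open>L * m - s\<close>, at least \<open>m - s\<close>.\<close>
  define Rem where "Rem = of_nat a * (X ^ (a0 + L * b) * P) + T * X ^ (L * b) + P' ^ a * S"
  have main: "P' ^ a * Q' ^ b = monom (of_real \<eta> ^ K) K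
      + (\<Sum>i\<le>l. monom (coeff y i * v i / v (N + i)) (N + i)) + Rem"
  proof -
    have XK: "monom (of_real \<eta> ^ K) K = X ^ (a + L * b)"
      by (simp add: Xpow K_def E_def mult_ac)
    have P'a: "P' ^ a = X ^ a + of_nat a * X ^ a0 * (P + H) + T"
      using T(1) by (simp add: P'_def a0 add_ac)
    have "P' ^ a * Q' ^ b = P' ^ a * X ^ (L * b) + P' ^ a * S"
      by (simp add: S(1) power_mult algebra_simps)
    also have "P' ^ a * X ^ (L * b) = X ^ (a + L * b) + of_nat a * X ^ (a0 + L * b) * H
        + (of_nat a * (X ^ (a0 + L * b) * P) + T * X ^ (L * b))"
      unfolding P'a by (simp add: power_add algebra_simps)
    finally show ?thesis by (simp add: XK XH Rem_def)
  qed
  have degRem: "degree Rem < N"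
  proof -
    have "degree (X ^ (a0 + L * b) * P) \<le> (K - m) + s"
      by (intro order_trans[OF degree_mult_le] add_mono degP order_trans[OF degXj]) (simp add: KE)
    then have "degree (of_nat a * (X ^ (a0 + L * b) * P)) \<le> (K - m) + s"
      by (intro order_trans[OF degree_mult_le]) (simp add: degree_of_nat)
    also have "\<dots> < N" using Km m by (simp add: N_def)
    finally have 1: "degree (of_nat a * (X ^ (a0 + L * b) * P)) < N" .
    have "degree (T * X ^ (L * b)) \<le> (a * m - 2 * (d - l)) + m * (L * b)"
      using T(2) by (intro order_trans[OF degree_mult_le] add_mono degXj) (simp add: a0)
    also have "\<dots> = K - 2 * (d - l)" using m a by (simp add: K_def E_def a0 algebra_simps)
    also have "\<dots> < N" using m d Km by (simp add: N_def)
    finally have 2: "degree (T * X ^ (L * b)) < N" .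
    have "degree (P' ^ a) \<le> a * m"
      by (rule order_trans[OF degree_power_le]) (use degP' in simp)
    then have "degree (P' ^ a * S) \<le> a * m + degree S"
      by (intro order_trans[OF degree_mult_le] add_mono) auto
    moreover have "m \<le> L * m" "K = a * m + b * (L * m)"
      by (simp_all add: K_def E_def L_def algebra_simps)
    ultimately have "S = 0 \<or> degree (P' ^ a * S) + m \<le> K + s"
      using S(2) by linarith
    then have 3: "degree (P' ^ a * S) < N"
      using m Km by (auto simp: N_def)
    show ?thesis unfolding Rem_def by (intro degree_add_less 1 2 3)
  qed
  \<comment> \<open>The image of the top monomial; by the choice of \<open>\<eta>\<close> its
    coefficient has modulus \<open>1 / norm (v d)\<close>.\<close>
  define D where "D = monom (of_real \<eta> ^ K * v K / v d) d"
  have image: "(B ^^ N) (poly (P' ^ a * Q' ^ b)) = poly (y + D)"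
  proof (rule Bpow_poly)
    fix n
    have "coeff Rem (n + N) = 0" using degRem by (intro coeff_eq_0) simp
    moreover have "(\<Sum>i\<le>l. coeff (monom (coeff y i * v i / v (N + i)) (N + i)) (n + N))
        = coeff y n * v n / v (n + N)"
    proof -
      have "(\<Sum>i\<le>l. coeff (monom (coeff y i * v i / v (N + i)) (N + i)) (n + N))
          = (\<Sum>i\<le>l. if i = n then coeff y n * v n / v (n + N) else 0)"
        by (intro sum.cong) (auto simp: add.commute)
      also have "\<dots> = coeff y n * v n / v (n + N)"
        using coeff_eq_0[of y n] by (auto simp: l_def)
      finally show ?thesis .
    qed
    ultimately have co: "coeff (P' ^ a * Q' ^ b) (n + N)
        = (if n = d then of_real \<eta> ^ K else 0) + coeff y n * v n / v (n + N)"
      using NK by (auto simp: main coeff_sum)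
    show "coeff (y + D) n = v (n + N) / v n * coeff (P' ^ a * Q' ^ b) (n + N)"
      unfolding co using NK by (auto simp: D_def add.commute field_simps)
  qed
  show ?thesis
  proof (rule that[of P' Q' N])
    show "near_pair r \<delta> (poly P) (poly Q) (poly P') (poly Q')"
      unfolding near_pair_def
    proof (intro allI impI conjI)
      fix z :: complex assume "norm z \<le> r"
      then have z: "norm z \<le> \<rho>" by (simp add: \<rho>_def)
      \<comment> \<open>\<open>j = 0\<close> serves for \<open>X\<close> and \<open>j = k\<close>
        for \<open>X ^ L\<close>.\<close>
      have Xz: "norm (poly (X ^ Suc j) z) \<le> (1/2) ^ m" for j
      proof -
        have "norm (poly (X ^ Suc j) z) = (\<eta> * norm z) ^ (m * Suc j)"
          using \<eta>0 by (simp add: Xpow poly_monom norm_mult norm_power power_mult_distrib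
              del: mult_Suc_right power_Suc)
        also have "\<dots> \<le> (\<eta> * \<rho>) ^ (m * Suc j)"
          using \<eta>0 z by (intro power_mono mult_left_mono) auto
        also have "\<dots> \<le> (1/2) ^ (m * Suc j)"
          using \<eta>0 \<rho> by (intro power_mono \<eta>\<rho>) auto
        also have "\<dots> \<le> (1/2) ^ m" by (intro power_decreasing) auto
        finally show ?thesis .
      qed
      show "norm (poly Q' z - poly Q z) \<le> \<delta>"
        using Xz[of k] m delta by (simp add: Q'_def L_def)
      have "norm (poly (monom (c i) (m - d + i)) z) \<le> (1/2) ^ m * norm (coeff y i * v i)"
        if "i \<le> l" for i
      proof -
        have Ni: "N + i = K - (d - i)" using that d NK by simp
        have "norm (v K) \<le> real C ^ (K * d) * norm (v (N + i))"
          unfolding Ni using C Km m by (intro weight_prod_ratio) auto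
        also have "K * d = (E * d) * m" by (simp add: K_def)
        finally have ratio: "norm (v K) / norm (v (N + i)) \<le> (real C ^ (E * d)) ^ m"
          by (simp add: power_mult divide_le_eq)
        \<comment> \<open>Since \<open>\<eta> ^ K = 1 / norm (v K)\<close>, dividing by
          \<open>\<eta> ^ (K - m)\<close> amounts to multiplying by
          \<open>norm (v K) * \<eta> ^ m\<close>. The spare factor \<open>\<eta> ^ m\<close> absorbs
          both the ratio of weight products and the powers of \<open>\<rho>\<close>.\<close>
        have \<eta>Km: "\<eta> ^ (K - m) = \<eta> ^ K / \<eta> ^ m"
          using Km \<eta>0 by (simp add: power_diff)
        have "norm (c i) = norm (coeff y i * v i) * (norm (v K) / norm (v (N + i))) * \<eta> ^ m / real a"
          using \<eta>0 by (simp add: c_def norm_mult norm_divide norm_power \<eta>Km \<eta>K field_simps)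
        also have "\<dots> \<le> norm (coeff y i * v i) * (norm (v K) / norm (v (N + i))) * \<eta> ^ m / 1"
          using a \<eta>0 by (intro divide_left_mono) auto
        also have "\<dots> \<le> norm (coeff y i * v i) * (real C ^ (E * d)) ^ m * \<eta> ^ m / 1"
          using \<eta>0 by (intro divide_right_mono mult_right_mono mult_left_mono ratio) auto
        finally have c: "norm (c i) \<le> norm (coeff y i * v i) * (real C ^ (E * d)) ^ m * \<eta> ^ m" by simp
        have "norm z ^ (m - d + i) \<le> \<rho> ^ (m - d + i)" using z by (intro power_mono) auto
        also have "\<dots> \<le> \<rho> ^ m" using \<rho> that d m by (intro power_increasing) auto
        finally have "norm (poly (monom (c i) (m - d + i)) z)
            \<le> (norm (coeff y i * v i) * (real C ^ (E * d)) ^ m * \<eta> ^ m) * \<rho> ^ m"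
          unfolding poly_monom norm_mult[of "c i"] norm_power[of z] using \<eta>0 by (intro mult_mono c) auto
        also have "\<dots> = (\<eta> * \<rho> * real C ^ (E * d)) ^ m * norm (coeff y i * v i)"
          by (simp add: power_mult_distrib mult_ac)
        also have "\<dots> \<le> (1/2) ^ m * norm (coeff y i * v i)"
          using \<eta>0 \<rho> by (intro mult_right_mono power_mono \<eta>) auto
        finally show ?thesis .
      qed
      then have "norm (poly H z) \<le> (\<Sum>i\<le>l. (1/2) ^ m * norm (coeff y i * v i))"
        unfolding H_def poly_sum by (intro sum_norm_le) auto
      also have "\<dots> = (1/2) ^ m * W" by (simp add: W_def sum_distrib_left)
      finally have "norm (poly H z) \<le> \<delta>/2" using m by simp
      moreover have "norm (poly X z) \<le> \<delta>/2" using Xz[of 0] m by simp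
      moreover have "poly P' z - poly P z = poly H z + poly X z" by (simp add: P'_def)
      ultimately show "norm (poly P' z - poly P z) \<le> \<delta>"
        using norm_triangle_ineq[of "poly H z" "poly X z"] by simp
    qed
    show "norm ((B ^^ N) (poly (P' ^ a * Q' ^ b)) z - poly y z) \<le> 1 / (2 * real k)"
      if z: "norm z \<le> real k" for z
    proof -
      have "norm ((B ^^ N) (poly (P' ^ a * Q' ^ b)) z - poly y z) = norm z ^ d / norm (v d)"
        using \<eta>0 by (simp add: image D_def poly_monom norm_mult norm_divide norm_power \<eta>K)
      also have "\<dots> \<le> real k ^ d / norm (v d)"
        using z by (intro divide_right_mono power_mono) auto
      also have "\<dots> \<le> real k ^ d / (2 * real k * real k) ^ d"
        using d(1) k by (intro divide_left_mono mult_pos_pos zero_less_power) auto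
      also have "\<dots> = 1 / (2 * real k) ^ d"
        using k by (simp add: power_mult_distrib)
      also have "\<dots> \<le> 1 / (2 * real k)"
        using k d(2) self_le_power[of "2 * real k" d] by (intro divide_left_mono) auto
      finally show ?thesis .
    qed
    show "(B ^^ N) (poly (P' ^ a' * Q' ^ b')) = (\<lambda>z. 0)"
      if a': "a' \<le> k" and less: "b' < b \<or> b' = b \<and> a' < a" for a' b'
    proof (rule Bpow_poly_small)
      \<comment> \<open>One unit less in the weighted exponent lowers the degree by
        \<open>m\<close>, which exceeds \<open>d = K - N\<close>.\<close>
      have "a' + b' * L + 1 \<le> E"
        using less
      proof
        assume "b' < b"
        then have "Suc b' * L \<le> b * L" by (intro mult_right_mono) auto
        then show ?thesis using a' a by (simp add: E_def L_def)
      qed (auto simp: E_def)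
      then have le: "(a' + b' * L + 1) * m \<le> K" unfolding K_def by (rule mult_right_mono) simp
      have "degree (P' ^ a' * Q' ^ b') \<le> a' * m + b' * (L * m)"
        by (intro order_trans[OF degree_mult_le] add_mono order_trans[OF degree_power_le])
           (use degP' degQ' in \<open>auto simp: mult.commute intro: mult_left_mono\<close>)
      then show "degree (P' ^ a' * Q' ^ b') < N"
        using le m NK by (simp add: algebra_simps)
    qed
  qed
qed

end

section \<open>Hypercyclicity and mixing\<close>

lemma entire_open_seminorm_ball: "entire_open {f \<in> entire_functions. sup_seminorm q f < 1}"
  unfolding entire_open_def
proof (intro conjI ballI)
  fix f assume "f \<in> {f \<in> entire_functions. sup_seminorm q f < 1}"
  then have f: "f \<in> entire_functions" "sup_seminorm q f < 1" by auto
  show "\<exists>p\<ge>1. \<exists>e>0. \<forall>g\<in>entire_functions. sup_seminorm p (\<lambda>z. g z - f z) < e \<longrightarrow>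
      g \<in> {f \<in> entire_functions. sup_seminorm q f < 1}"
  proof (intro exI[of _ "max 1 q"] exI[of _ "1 - sup_seminorm q f"] conjI ballI impI)
    fix g assume g: "g \<in> entire_functions"
      and lt: "sup_seminorm (max 1 q) (\<lambda>z. g z - f z) < 1 - sup_seminorm q f"
    have gf: "(\<lambda>z. g z - f z) \<in> entire_functions" by (intro entire_intros f g)
    have "sup_seminorm q g \<le> sup_seminorm (max 1 q) (\<lambda>z. g z - f z) + sup_seminorm q f"
    proof (rule sup_seminorm_le)
      fix z :: complex assume z: "norm z \<le> real q"
      have "norm (g z) \<le> norm (g z - f z) + norm (f z)"
        using norm_triangle_ineq[of "g z - f z" "f z"] by simp
      also have "\<dots> \<le> sup_seminorm (max 1 q) (\<lambda>z. g z - f z) + sup_seminorm q f"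
        using z by (intro add_mono le_sup_seminorm[OF gf] le_sup_seminorm[OF f(1)]) auto
      finally show "norm (g z) \<le> \<dots>" .
    qed
    then show "g \<in> {f \<in> entire_functions. sup_seminorm q f < 1}" using g lt by simp
  qed (use f in auto)
qed auto

lemma entire_open_eval_ball: "entire_open {f \<in> entire_functions. norm (f 0 - c) < 1}"
  unfolding entire_open_def
proof (intro conjI ballI)
  fix f assume "f \<in> {f \<in> entire_functions. norm (f 0 - c) < 1}"
  then have f: "f \<in> entire_functions" "norm (f 0 - c) < 1" by auto
  show "\<exists>p\<ge>1. \<exists>e>0. \<forall>g\<in>entire_functions. sup_seminorm p (\<lambda>z. g z - f z) < e \<longrightarrow>
      g \<in> {f \<in> entire_functions. norm (f 0 - c) < 1}"
  proof (intro exI[of _ "1::nat"] exI[of _ "1 - norm (f 0 - c)"] conjI ballI impI)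
    fix g assume g: "g \<in> entire_functions"
      and lt: "sup_seminorm 1 (\<lambda>z. g z - f z) < 1 - norm (f 0 - c)"
    have gf: "(\<lambda>z. g z - f z) \<in> entire_functions" by (intro entire_intros f g)
    have "norm (g 0 - c) \<le> norm (g 0 - f 0) + norm (f 0 - c)"
      using norm_triangle_ineq[of "g 0 - f 0" "f 0 - c"] by simp
    also have "\<dots> < 1" using le_sup_seminorm[OF gf, of 0 1] lt by simp
    finally show "g \<in> {f \<in> entire_functions. norm (f 0 - c) < 1}" using g by simp
  qed (use f in auto)
qed auto

text \<open>Balls of a single seminorm form a neighbourhood base, so density reduces to
  approximation on one disc at a time. As \<open>T\<close> is arbitrary, the approximating iterate
  must be required to be entire.\<close>

lemma hypercyclic_vectorsI:
  assumes x: "x \<in> entire_functions"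
    and dense: "\<And>F q e. F \<in> entire_functions \<Longrightarrow> q \<ge> 1 \<Longrightarrow> e > 0 \<Longrightarrow>
      \<exists>n. (T ^^ n) x \<in> entire_functions \<and> (\<forall>z. norm z \<le> real q \<longrightarrow> norm ((T ^^ n) x z - F z) \<le> e)"
  shows "x \<in> hypercyclic_vectors entire_topology T"
  unfolding hypercyclic_vectors_def topspace_entire_topology mem_Collect_eq
proof (intro conjI x subset_antisym)
  show "entire_topology closure_of range (\<lambda>n. (T ^^ n) x) \<subseteq> entire_functions"
    using closure_of_subset_topspace[of entire_topology] by (simp add: topspace_entire_topology)
  show "entire_functions \<subseteq> entire_topology closure_of range (\<lambda>n. (T ^^ n) x)"
  proof
    fix F assume F: "F \<in> entire_functions"
    have "\<exists>y\<in>range (\<lambda>n. (T ^^ n) x). y \<in> U" if U: "entire_open U" "F \<in> U" for U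
    proof -
      obtain q e where q: "q \<ge> 1" "e > 0"
        "\<And>g. g \<in> entire_functions \<Longrightarrow> sup_seminorm q (\<lambda>z. g z - F z) < e \<Longrightarrow> g \<in> U"
        using U unfolding entire_open_def by blast
      obtain n where n: "(T ^^ n) x \<in> entire_functions"
        "\<forall>z. norm z \<le> real q \<longrightarrow> norm ((T ^^ n) x z - F z) \<le> e / 2"
        using dense[OF F q(1), of "e/2"] q(2) by auto
      have "sup_seminorm q (\<lambda>z. (T ^^ n) x z - F z) \<le> e / 2"
        using n(2) by (intro sup_seminorm_le) auto
      then show ?thesis using q(2) q(3)[OF n(1)] by auto
    qed
    then show "F \<in> entire_topology closure_of range (\<lambda>n. (T ^^ n) x)"
      using F by (auto simp: in_closure_of topspace_entire_topology openin_entire_topology)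
  qed
qed

text \<open>The set consists of the polynomials whose coefficients come from a countable dense
  subset of the plane.\<close>

lemma countable_dense_polys:
  obtains D :: "complex poly set" where "countable D"
    "\<And>F r e. F \<in> entire_functions \<Longrightarrow> e > 0 \<Longrightarrow>
       \<exists>y\<in>D. \<forall>z. norm z \<le> r \<longrightarrow> norm (F z - poly y z) \<le> e"
proof -
  obtain C :: "complex set" where C: "countable C" "\<And>X. open X \<Longrightarrow> X \<noteq> {} \<Longrightarrow> \<exists>d\<in>C. d \<in> X"
    using countable_dense_exists by blast
  define D where "D = (\<lambda>cs. \<Sum>i<length cs. monom (cs ! i) i) ` lists C"
  show ?thesis
  proof (rule that[of D])
    show "countable D" unfolding D_def using C(1) by (intro countable_image countable_lists)
    fix F r and e :: real assume F: "F \<in> entire_functions" and e: "e > 0"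
    obtain P where P: "\<And>z. norm z \<le> r \<Longrightarrow> norm (F z - poly P z) \<le> e/2"
      by (rule poly_approx_entire[OF F, of "e/2" r]) (use e in auto)
    define n where "n = Suc (degree P)"
    \<comment> \<open>Coefficient errors of \<open>e / 2 / M\<close> add up to at most
      \<open>e / 2\<close> on the disc. The absolute value allows negative \<open>r\<close>, and the
      term for \<open>i = 0\<close> makes \<open>M\<close> positive.\<close>
    define M where "M = (\<Sum>i<n. \<bar>r\<bar> ^ i)"
    have "\<bar>r\<bar> ^ 0 \<le> M" unfolding M_def by (rule member_le_sum) (auto simp: n_def)
    then have M: "M > 0" by simp
    have "\<exists>d\<in>C. norm (d - coeff P i) \<le> e / 2 / M" for i
    proof -
      have "e / 2 / M > 0" using e M by simp
      then have "ball (coeff P i) (e / 2 / M) \<noteq> {}" by (simp only: ball_eq_empty not_le)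
      then obtain d where "d \<in> C" "d \<in> ball (coeff P i) (e / 2 / M)" using C(2) by blast
      then show ?thesis by (intro bexI[of _ d]) (auto simp: dist_norm norm_minus_commute)
    qed
    then obtain c where c: "\<And>i. c i \<in> C" "\<And>i. norm (c i - coeff P i) \<le> e / 2 / M" by metis
    define y where "y = (\<Sum>i<n. monom (c i) i)"
    have "y \<in> D" unfolding D_def
      by (rule image_eqI[of _ _ "map c [0..<n]"]) (use c(1) in \<open>auto simp: y_def\<close>)
    moreover have "norm (F z - poly y z) \<le> e" if z: "norm z \<le> r" for z
    proof -
      have "poly P z = (\<Sum>i<n. coeff P i * z ^ i)"
        by (simp add: poly_altdef n_def lessThan_Suc_atMost)
      then have "poly y z - poly P z = (\<Sum>i<n. (c i - coeff P i) * z ^ i)"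
        by (simp add: y_def poly_sum poly_monom sum_subtractf left_diff_distrib)
      also have "norm \<dots> \<le> (\<Sum>i<n. e / 2 / M * \<bar>r\<bar> ^ i)"
      proof (rule sum_norm_le)
        fix i
        show "norm ((c i - coeff P i) * z ^ i) \<le> e / 2 / M * \<bar>r\<bar> ^ i"
          unfolding norm_mult norm_power using z e M by (intro mult_mono power_mono c(2)) auto
      qed
      also have "\<dots> = e / 2 / M * M" by (simp only: M_def sum_distrib_left)
      also have "\<dots> = e / 2" using M by simp
      finally show ?thesis
        using P[OF z] norm_triangle_ineq[of "F z - poly P z" "poly P z - poly y z"]
        by (simp add: norm_minus_commute)
    qed
    ultimately show "\<exists>y\<in>D. \<forall>z. norm z \<le> r \<longrightarrow> norm (F z - poly y z) \<le> e" by blast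
  qed
qed

section \<open>Algebras spanned by monomials in two functions\<close>

definition monomial_span ::
    "(nat \<times> nat) set \<Rightarrow> (complex \<Rightarrow> complex) \<Rightarrow> (complex \<Rightarrow> complex) \<Rightarrow> (complex \<Rightarrow> complex) set" where
  "monomial_span \<Gamma> f g = {h. \<exists>I c. finite I \<and> I \<subseteq> \<Gamma> \<and>
     h = (\<lambda>z. \<Sum>p\<in>I. c p * (f z ^ fst p * g z ^ snd p))}"

lemma monomial_spanI:
  "finite I \<Longrightarrow> I \<subseteq> \<Gamma> \<Longrightarrow> (\<lambda>z. \<Sum>p\<in>I. c p * (f z ^ fst p * g z ^ snd p)) \<in> monomial_span \<Gamma> f g"
  unfolding monomial_span_def by blast

lemma monomial_span_mono: "\<Gamma> \<subseteq> \<Delta> \<Longrightarrow> monomial_span \<Gamma> f g \<subseteq> monomial_span \<Delta> f g"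
  unfolding monomial_span_def by blast

lemma monomial_span_monomial:
  "(a, b) \<in> \<Gamma> \<Longrightarrow> (\<lambda>z. f z ^ a * g z ^ b) \<in> monomial_span \<Gamma> f g"
  using monomial_spanI[of "{(a, b)}" \<Gamma> "\<lambda>_. 1" f g] by simp

lemma monomial_span_zero: "(\<lambda>z. 0) \<in> monomial_span \<Gamma> f g"
  using monomial_spanI[of "{}" \<Gamma> _ f g] by simp

lemma monomial_span_cmult:
  assumes "h \<in> monomial_span \<Gamma> f g"
  shows "(\<lambda>z. k * h z) \<in> monomial_span \<Gamma> f g"
proof -
  obtain I c where I: "finite I" "I \<subseteq> \<Gamma>" and h: "h = (\<lambda>z. \<Sum>p\<in>I. c p * (f z ^ fst p * g z ^ snd p))"
    using assms unfolding monomial_span_def by blast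
  show ?thesis
    using monomial_spanI[OF I, of "\<lambda>p. k * c p" f g] by (simp add: h sum_distrib_left mult_ac)
qed

lemma monomial_span_add:
  assumes "h \<in> monomial_span \<Gamma> f g" "h' \<in> monomial_span \<Gamma> f g"
  shows "(\<lambda>z. h z + h' z) \<in> monomial_span \<Gamma> f g"
proof -
  let ?m = "\<lambda>p z. f z ^ fst p * g z ^ snd p"
  obtain I c where I: "finite I" "I \<subseteq> \<Gamma>" and h: "h = (\<lambda>z. \<Sum>p\<in>I. c p * ?m p z)"
    using assms(1) unfolding monomial_span_def by blast
  obtain J d where J: "finite J" "J \<subseteq> \<Gamma>" and h': "h' = (\<lambda>z. \<Sum>p\<in>J. d p * ?m p z)"
    using assms(2) unfolding monomial_span_def by blast
  let ?e = "\<lambda>p. (if p \<in> I then c p else 0) + (if p \<in> J then d p else 0)"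
  have "h z = (\<Sum>p\<in>I \<union> J. (if p \<in> I then c p else 0) * ?m p z)" for z
    unfolding h using I(1) J(1) by (intro sum.mono_neutral_cong_left) auto
  moreover have "h' z = (\<Sum>p\<in>I \<union> J. (if p \<in> J then d p else 0) * ?m p z)" for z
    unfolding h' using I(1) J(1) by (intro sum.mono_neutral_cong_left) auto
  ultimately have "(\<lambda>z. h z + h' z) = (\<lambda>z. \<Sum>p\<in>I \<union> J. ?e p * ?m p z)"
    by (simp add: sum.distrib distrib_right)
  then show ?thesis using monomial_spanI[of "I \<union> J" \<Gamma> ?e f g] I J by simp
qed

lemma monomial_span_sum:
  assumes "finite S" "\<And>s. s \<in> S \<Longrightarrow> h s \<in> monomial_span \<Gamma> f g"
  shows "(\<lambda>z. \<Sum>s\<in>S. h s z) \<in> monomial_span \<Gamma> f g"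
  using assms by (induction S rule: finite_induct) (auto intro: monomial_span_zero monomial_span_add)

lemma monomial_span_mult:
  assumes \<Gamma>: "\<And>a b a' b'. (a, b) \<in> \<Gamma> \<Longrightarrow> (a', b') \<in> \<Gamma> \<Longrightarrow> (a + a', b + b') \<in> \<Gamma>"
    and "h \<in> monomial_span \<Gamma> f g" "h' \<in> monomial_span \<Gamma> f g"
  shows "(\<lambda>z. h z * h' z) \<in> monomial_span \<Gamma> f g"
proof -
  let ?m = "\<lambda>p z. f z ^ fst p * g z ^ snd p"
  obtain I c where I: "finite I" "I \<subseteq> \<Gamma>" and h: "h = (\<lambda>z. \<Sum>p\<in>I. c p * ?m p z)"
    using assms(2) unfolding monomial_span_def by blast
  obtain J d where J: "finite J" "J \<subseteq> \<Gamma>" and h': "h' = (\<lambda>z. \<Sum>p\<in>J. d p * ?m p z)"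
    using assms(3) unfolding monomial_span_def by blast
  have "(\<lambda>z. h z * h' z) = (\<lambda>z. \<Sum>p\<in>I. \<Sum>r\<in>J.
      (c p * d r) * (f z ^ (fst p + fst r) * g z ^ (snd p + snd r)))"
    by (simp add: h h' sum_product power_add mult_ac)
  also have "\<dots> \<in> monomial_span \<Gamma> f g"
    using I J by (intro monomial_span_sum monomial_span_cmult monomial_span_monomial \<Gamma>) auto
  finally show ?thesis .
qed

lemma monomial_span_subalgebra:
  assumes "\<And>a b a' b'. (a, b) \<in> \<Gamma> \<Longrightarrow> (a', b') \<in> \<Gamma> \<Longrightarrow> (a + a', b + b') \<in> \<Gamma>"
    and "f \<in> entire_functions" "g \<in> entire_functions"
  shows "entire_subalgebra (monomial_span \<Gamma> f g)"
proof -
  have "(\<lambda>z. \<Sum>p\<in>I. c p * (f z ^ fst p * g z ^ snd p)) \<in> entire_functions" for I c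
    by (intro entire_sum entire_intros assms)
  then have "monomial_span \<Gamma> f g \<subseteq> entire_functions"
    unfolding monomial_span_def by blast
  then show ?thesis
    unfolding entire_subalgebra_def
    by (intro conjI ballI allI monomial_span_zero monomial_span_add monomial_span_cmult
        monomial_span_mult[OF assms(1)])
qed

text \<open>The span of the monomials \<open>f\<^sup>a g\<^sup>b\<close> with \<open>a \<ge> 1\<close> is not finitely generated when the monomials are
  linearly independent: finitely many of its elements only involve exponents with
  \<open>b \<le> R a\<close> for some \<open>R\<close>, and so does the algebra that they generate.\<close>

lemma algebrableI:
  assumes f: "f \<in> entire_functions" and g: "g \<in> entire_functions" and zero: "(\<lambda>z. 0) \<notin> M"
    and M: "\<And>I c. finite I \<Longrightarrow> I \<subseteq> {(a, b). a \<ge> 1} \<Longrightarrow> \<exists>p\<in>I. c p \<noteq> 0 \<Longrightarrow>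
      (\<lambda>z. \<Sum>p\<in>I. c p * (f z ^ fst p * g z ^ snd p)) \<in> M"
  shows "algebrable M"
proof -
  define A where "A = monomial_span {(a, b). a \<ge> 1} f g"
  define A' where "A' R = monomial_span {(a, b). a \<ge> 1 \<and> b \<le> R * a} f g" for R
  have A: "entire_subalgebra A"
    unfolding A_def by (rule monomial_span_subalgebra) (use f g in auto)
  have A': "entire_subalgebra (A' R)" for R
    unfolding A'_def by (rule monomial_span_subalgebra) (use f g in \<open>auto simp: algebra_simps\<close>)
  have sub: "A \<subseteq> M \<union> {\<lambda>z. 0}"
  proof
    fix h assume "h \<in> A"
    then obtain I c where I: "finite I" "I \<subseteq> {(a, b). a \<ge> 1}"
      and h: "h = (\<lambda>z. \<Sum>p\<in>I. c p * (f z ^ fst p * g z ^ snd p))"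
      unfolding A_def monomial_span_def by blast
    show "h \<in> M \<union> {\<lambda>z. 0}"
    proof (cases "\<exists>p\<in>I. c p \<noteq> 0")
      case True
      then show ?thesis unfolding h using M[OF I] by blast
    qed (simp add: h)
  qed
  \<comment> \<open>Membership would make a combination with coefficient -1 at
    \<open>(1, Suc R)\<close> vanish identically, although \<open>M\<close> contains it and omits
    0.\<close>
  have not_A': "(\<lambda>z. f z ^ 1 * g z ^ Suc R) \<notin> A' R" for R
  proof
    assume "(\<lambda>z. f z ^ 1 * g z ^ Suc R) \<in> A' R"
    then obtain I c where I: "finite I" "I \<subseteq> {(a, b). a \<ge> 1 \<and> b \<le> R * a}"
      and eq: "(\<lambda>z. f z ^ 1 * g z ^ Suc R) = (\<lambda>z. \<Sum>p\<in>I. c p * (f z ^ fst p * g z ^ snd p))"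
      unfolding A'_def monomial_span_def by blast
    define c' where "c' = c((1, Suc R) := -1)"
    have notin: "(1, Suc R) \<notin> I" using I by auto
    have "(\<lambda>z. \<Sum>p\<in>insert (1, Suc R) I. c' p * (f z ^ fst p * g z ^ snd p)) \<in> M"
      using I by (intro M) (auto simp: c'_def)
    moreover have "(\<Sum>p\<in>insert (1, Suc R) I. c' p * (f z ^ fst p * g z ^ snd p)) = 0" for z
    proof -
      have "(\<Sum>p\<in>I. c' p * (f z ^ fst p * g z ^ snd p)) = (\<Sum>p\<in>I. c p * (f z ^ fst p * g z ^ snd p))"
        using notin by (intro sum.cong) (auto simp: c'_def)
      also have "\<dots> = f z ^ 1 * g z ^ Suc R" using fun_cong[OF eq, of z] by simp
      finally show ?thesis using notin I(1) by (simp add: c'_def)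
    qed
    ultimately show False using zero by simp
  qed
  have not_fg: "\<not> (\<exists>S. finite S \<and> generates S A)"
  proof
    assume "\<exists>S. finite S \<and> generates S A"
    then obtain S where S: "finite S" "S \<subseteq> A" "entire_subalgebra hull S = A"
      unfolding generates_def by blast
    have mono: "A' R \<subseteq> A' R'" if "R \<le> R'" for R R'
      unfolding A'_def
    proof (rule monomial_span_mono, safe)
      fix a b assume "b \<le> R * a"
      then show "b \<le> R' * a" using mult_le_mono1[OF that, of a] by linarith
    qed
    have one: "\<exists>R. s \<in> A' R" if s: "s \<in> A" for s
    proof -
      obtain I c where I: "finite I" "I \<subseteq> {(a, b). a \<ge> 1}"
        and s: "s = (\<lambda>z. \<Sum>p\<in>I. c p * (f z ^ fst p * g z ^ snd p))"
        using s unfolding A_def monomial_span_def by blast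
      \<comment> \<open>The sum of all second exponents serves as slope, because
        \<open>a \<ge> 1\<close>.\<close>
      have "I \<subseteq> {(a, b). a \<ge> 1 \<and> b \<le> (\<Sum>p\<in>I. snd p) * a}"
      proof safe
        fix a b assume ab: "(a, b) \<in> I"
        then show "a \<ge> 1" using I by auto
        moreover have "b \<le> (\<Sum>p\<in>I. snd p)"
          using member_le_sum[of "(a, b)" I snd] ab I by simp
        ultimately show "b \<le> (\<Sum>p\<in>I. snd p) * a"
          using mult_le_mono[of b "\<Sum>p\<in>I. snd p" 1 a] by simp
      qed
      then show ?thesis unfolding A'_def s using monomial_spanI[OF I(1)] by blast
    qed
    have "\<exists>R. S \<subseteq> A' R"
      using S(1,2)
    proof (induction S rule: finite_induct)
      case (insert s S)
      obtain R R' where R: "S \<subseteq> A' R" "s \<in> A' R'"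
        using insert.IH insert.prems one[of s] by auto
      have "A' R \<subseteq> A' (max R R')" "A' R' \<subseteq> A' (max R R')" by (intro mono; simp)+
      then have "insert s S \<subseteq> A' (max R R')" using R by blast
      then show ?case ..
    qed simp
    then obtain R where "S \<subseteq> A' R" by blast
    then have "A \<subseteq> A' R" unfolding S(3)[symmetric] using A' by (rule hull_minimal)
    moreover have "(\<lambda>z. f z ^ 1 * g z ^ Suc R) \<in> A"
      unfolding A_def by (rule monomial_span_monomial) simp
    ultimately show False using not_A' by blast
  qed
  have gen: "generates A A" unfolding generates_def using hull_same[of entire_subalgebra, OF A] by blast
  then have "infinite A" using not_fg by blast
  then show ?thesis unfolding algebrable_def using A sub gen not_fg by blast
qed

section \<open>Mixing and the growth of the weight products\<close>

context entire_shift
begin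

lemma zero_not_hypercyclic: "(\<lambda>z. 0) \<notin> hypercyclic_vectors entire_topology B"
proof
  define V where "V = {f \<in> entire_functions. norm (f 0 - 2) < 1}"
  assume "(\<lambda>z. 0) \<in> hypercyclic_vectors entire_topology B"
  then have "(\<lambda>z. 2) \<in> entire_topology closure_of range (\<lambda>n. (B ^^ n) (\<lambda>z. 0))"
    by (simp add: hypercyclic_vectors_def topspace_entire_topology entire_intros)
  then have "(\<lambda>z. 2) \<in> V \<and> openin entire_topology V \<longrightarrow> (\<exists>y. y \<in> range (\<lambda>n. (B ^^ n) (\<lambda>z. 0)) \<and> y \<in> V)"
    unfolding in_closure_of by (elim conjE allE)
  moreover have "openin entire_topology V"
    unfolding openin_entire_topology V_def by (rule entire_open_eval_ball)
  moreover have "(\<lambda>z. 2) \<in> V" by (simp add: V_def entire_intros)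
  ultimately obtain n where "(B ^^ n) (\<lambda>z. 0) \<in> V" by auto
  then show False by (simp add: Bpow_zero V_def)
qed

text \<open>If \<open>f\<close> is bounded by 1 on the disc of radius \<open>q\<close>, its
  \<open>n\<close>-th coefficient is at most \<open>1 / q ^ n\<close>. Mixing provides, for all
  large \<open>n\<close>, such an \<open>f\<close> for which \<open>(B ^^ n) f 0\<close>, which is
  \<open>v n\<close> times that coefficient, lies within 1 of 2 and so has modulus at least
  1.\<close>

lemma mixing_imp_growing:
  assumes "mixing entire_topology B"
  shows "growing_entire_shift w"
proof
  fix R :: real
  obtain q' :: nat where q': "\<bar>R\<bar> \<le> real q'" using real_arch_simple by blast
  define q where "q = max 1 q'"
  have q: "q \<ge> 1" "\<bar>R\<bar> \<le> real q" using q' by (auto simp: q_def)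
  define U where "U = {f \<in> entire_functions. sup_seminorm q f < 1}"
  define V where "V = {f \<in> entire_functions. norm (f 0 - 2) < 1}"
  have "sup_seminorm q (\<lambda>z. 0) \<le> 0" by (rule sup_seminorm_le) simp
  then have "(\<lambda>z. 0) \<in> U" by (simp add: U_def entire_intros)
  moreover have "(\<lambda>z. 2) \<in> V" by (simp add: V_def entire_intros)
  moreover have "entire_open U" "entire_open V"
    unfolding U_def V_def by (rule entire_open_seminorm_ball entire_open_eval_ball)+
  ultimately have "finite (- {n. (B ^^ n) ` U \<inter> V \<noteq> {}})"
    using assms unfolding mixing_def openin_entire_topology by blast
  then have "\<forall>\<^sub>F n in sequentially. (B ^^ n) ` U \<inter> V \<noteq> {}"
    by (simp only: cofinite_eq_sequentially[symmetric] eventually_cofinite Collect_neg_eq)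
  then show "\<forall>\<^sub>F n in sequentially. R ^ n \<le> norm (v n)"
  proof eventually_elim
    case (elim n)
    then obtain f where f: "f \<in> U" and Bf: "(B ^^ n) f \<in> V" by blast
    have fe: "f \<in> entire_functions" using f by (simp add: U_def)
    have "norm (f z) \<le> 1" if "norm z \<le> real q" for z
      using le_sup_seminorm[OF fe that] f by (simp add: U_def)
    then have co: "norm (fps_nth (taylor f) n) \<le> 1 / real q ^ n"
      by (rule taylor_coeff_bound[OF fe q(1)])
    have "(B ^^ n) f 0 = v n * fps_nth (taylor f) n"
      using eval_taylor[OF Bpow_entire[OF fe], of n 0]
      by (simp add: eval_fps_at_0 taylor_Bpow[OF fe] shift_coeffs_funpow[OF weight])
    moreover have "norm ((B ^^ n) f 0) \<ge> 1"
      using Bf norm_triangle_ineq2[of "2::complex" "2 - (B ^^ n) f 0"]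
      by (simp add: V_def norm_minus_commute)
    ultimately have "1 \<le> norm (v n) * norm (fps_nth (taylor f) n)" by (simp add: norm_mult)
    also have "\<dots> \<le> norm (v n) * (1 / real q ^ n)" by (intro mult_left_mono co) auto
    finally have "real q ^ n \<le> norm (v n)" using q(1) by (simp add: field_simps)
    moreover have "R ^ n \<le> real q ^ n"
      using q(2) power_mono[of "\<bar>R\<bar>" "real q" n] abs_ge_self[of "R ^ n"] by (simp add: power_abs)
    ultimately show ?case by linarith
  qed
qed

end

context growing_entire_shift
begin

text \<open>Add to a polynomial \<open>P\<close> in \<open>U\<close> the preimage \<open>H\<close>
  of a polynomial \<open>y\<close> in \<open>V\<close> under \<open>B ^^ n\<close>. Growth makes
  \<open>H\<close> small, and \<open>B ^^ n\<close> annihilates \<open>P\<close> once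
  \<open>n\<close> exceeds its degree. This yields mixing for differentiation.\<close>

lemma growing_imp_mixing: "mixing entire_topology B"
  unfolding mixing_def openin_entire_topology
proof (intro allI impI)
  fix U V assume U: "entire_open U" and V: "entire_open V" and "U \<noteq> {}" "V \<noteq> {}"
  then obtain f0 g0 where f0: "f0 \<in> U" and g0: "g0 \<in> V" by blast
  have ent: "f0 \<in> entire_functions" "g0 \<in> entire_functions"
    using U V f0 g0 unfolding entire_open_def by auto
  obtain q e where q: "q \<ge> 1" "e > 0"
      "\<And>g. g \<in> entire_functions \<Longrightarrow> sup_seminorm q (\<lambda>z. g z - f0 z) < e \<Longrightarrow> g \<in> U"
    using U f0 unfolding entire_open_def by blast
  obtain q' e' where q': "q' \<ge> 1" "e' > 0"
      "\<And>g. g \<in> entire_functions \<Longrightarrow> sup_seminorm q' (\<lambda>z. g z - g0 z) < e' \<Longrightarrow> g \<in> V"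
    using V g0 unfolding entire_open_def by blast
  obtain P where P: "\<And>z. norm z \<le> real q \<Longrightarrow> norm (f0 z - poly P z) \<le> e / 3"
    by (rule poly_approx_entire[OF ent(1), of "e/3" "real q"]) (use q in auto)
  obtain y where y: "\<And>z. norm z \<le> real q' \<Longrightarrow> norm (g0 z - poly y z) \<le> e' / 2"
    by (rule poly_approx_entire[OF ent(2), of "e'/2" "real q'"]) (use q' in auto)
  have "sup_seminorm q' (\<lambda>z. poly y z - g0 z) \<le> e' / 2"
    using y by (intro sup_seminorm_le) (simp add: norm_minus_commute)
  then have yV: "poly y \<in> V" using q'(2) by (intro q'(3) entire_intros) auto
  define l where "l = degree y"
  define W where "W = (\<Sum>i\<le>l. norm (coeff y i * v i))"
  have "(\<lambda>n. (1/2) ^ n * W) \<longlonglongrightarrow> 0"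
    by (intro tendsto_mult_left_zero LIMSEQ_realpow_zero) auto
  then have "\<forall>\<^sub>F n in sequentially. (1/2) ^ n * W < e / 3"
    using q(2) by (auto dest: order_tendstoD(2)[of _ _ _ "e/3"])
  moreover have "\<forall>\<^sub>F n in sequentially. n \<ge> Suc (degree P)" by (rule eventually_ge_at_top)
  \<comment> \<open>All later indices are included because \<open>H\<close> involves
    \<open>v (n + i)\<close> for every \<open>i \<le> l\<close>.\<close>
  moreover have "\<forall>\<^sub>F n in sequentially. \<forall>m\<ge>n. (2 * real q) ^ m \<le> norm (v m)"
    by (rule eventually_all_ge_at_top[OF growth])
  ultimately have "\<forall>\<^sub>F n in sequentially. (B ^^ n) ` U \<inter> V \<noteq> {}"
  proof eventually_elim
    case (elim n)
    have large: "(2 * real q) ^ (n + i) \<le> norm (v (n + i))" for i using elim(3) by simp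
    define H where "H = (\<Sum>i\<le>l. monom (coeff y i * v i / v (n + i)) (n + i))"
    have "norm (poly (P + H) z - f0 z) \<le> 2 * e / 3" if z: "norm z \<le> real q" for z
    proof -
      have "norm (poly (monom (coeff y i * v i / v (n + i)) (n + i)) z)
          \<le> (1/2) ^ n * norm (coeff y i * v i)" for i
      proof -
        have "norm (poly (monom (coeff y i * v i / v (n + i)) (n + i)) z)
            = norm (coeff y i * v i) * (norm z ^ (n + i) / norm (v (n + i)))"
          by (simp add: poly_monom norm_mult norm_divide norm_power)
        also have "\<dots> \<le> norm (coeff y i * v i) * (real q ^ (n + i) / (2 * real q) ^ (n + i))"
          using q(1) by (intro mult_left_mono frac_le power_mono large z) auto
        also have "\<dots> = norm (coeff y i * v i) * (1/2) ^ (n + i)"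
          using q(1) by (simp add: power_mult_distrib power_divide)
        also have "\<dots> \<le> norm (coeff y i * v i) * (1/2) ^ n"
          by (intro mult_left_mono power_decreasing) auto
        finally show ?thesis by (simp add: mult.commute)
      qed
      then have "norm (poly H z) \<le> (\<Sum>i\<le>l. (1/2) ^ n * norm (coeff y i * v i))"
        unfolding H_def poly_sum by (intro sum_norm_le) auto
      also have "\<dots> \<le> e / 3" using elim(1) by (simp add: W_def sum_distrib_left)
      finally show ?thesis
        using P[OF z] norm_triangle_ineq[of "poly H z" "poly P z - f0 z"]
        by (simp add: norm_minus_commute algebra_simps)
    qed
    then have "sup_seminorm q (\<lambda>z. poly (P + H) z - f0 z) \<le> 2 * e / 3"
      by (intro sup_seminorm_le)
    then have "poly (P + H) \<in> U" using q(2) by (intro q(3) entire_intros) auto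
    moreover have "(B ^^ n) (poly (P + H)) = poly y"
    proof (rule Bpow_poly)
      fix j
      have "coeff P (j + n) = 0" using elim(2) by (intro coeff_eq_0) simp
      moreover have "coeff H (j + n) = (\<Sum>i\<le>l. if i = j then coeff y j * v j / v (j + n) else 0)"
        unfolding H_def coeff_sum by (intro sum.cong) (auto simp: add.commute)
      ultimately have "coeff (P + H) (j + n) = coeff y j * v j / v (j + n)"
        using coeff_eq_0[of y j] by (auto simp: l_def)
      then show "coeff y j = v (j + n) / v j * coeff (P + H) (j + n)" by simp
    qed
    ultimately have "poly y \<in> (B ^^ n) ` U" by (metis imageI)
    then show "(B ^^ n) ` U \<inter> V \<noteq> {}" using yV by blast
  qed
  then show "finite (- {n. (B ^^ n) ` U \<inter> V \<noteq> {}})"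
    by (simp only: cofinite_eq_sequentially[symmetric] eventually_cofinite Collect_neg_eq)
qed

section \<open>Pairs of functions with hypercyclic polynomial combinations\<close>

text \<open>If \<open>(a, b)\<close> is the leading exponent of a polynomial in \<open>f\<close> and \<open>g\<close>, second exponents being compared
  first, then \<open>B\<^sup>N\<close> maps that polynomial close to the multiple of \<open>y\<close> by its leading coefficient.\<close>

definition separates :: "(complex \<Rightarrow> complex) \<Rightarrow> (complex \<Rightarrow> complex) \<Rightarrow>
    nat \<Rightarrow> nat \<Rightarrow> complex poly \<Rightarrow> nat \<Rightarrow> bool" where
  "separates f g a b y k \<longleftrightarrow> (\<exists>N. \<forall>z. norm z \<le> real k \<longrightarrow>
     norm ((B ^^ N) (\<lambda>z. f z ^ a * g z ^ b) z - poly y z) \<le> 1 / real k \<and>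
     (\<forall>a' b'. a' \<le> k \<longrightarrow> b' < b \<or> b' = b \<and> a' < a \<longrightarrow>
        norm ((B ^^ N) (\<lambda>z. f z ^ a' * g z ^ b') z) \<le> 1 / real k))"

text \<open>Baire category over the countably many \<open>(a, b, y, k)\<close>:
  \<open>monomial_perturbation\<close> supplies density with tolerance \<open>1 / (2 * k)\<close>,
  and continuity spends the other half of \<open>1 / k\<close> on a ball.\<close>

lemma separating_pair:
  assumes "countable D"
  obtains f g where "f \<in> entire_functions" "g \<in> entire_functions"
    "\<And>a b y k. a \<ge> 1 \<Longrightarrow> y \<in> D \<Longrightarrow> k \<ge> 1 \<Longrightarrow> separates f g a b y k"
proof -
  define J where "J = {1::nat..} \<times> (UNIV :: nat set) \<times> D \<times> {1::nat..}"
  define G where "G = (\<lambda>(a, b, y, k) f g. separates f g a b y k)"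
  have "countable J" unfolding J_def by (intro countable_SIGMA countableI_type assms)
  then obtain f g where "f \<in> entire_functions" "g \<in> entire_functions" "\<And>i. i \<in> J \<Longrightarrow> G i f g"
  proof (rule baire_entire_pairs[where G = G])
    fix i P Q r and \<delta> :: real assume i: "i \<in> J" and \<delta>: "\<delta> > 0"
    obtain a b y k where abyk: "i = (a, b, y, k)" by (cases i)
    have a: "a \<ge> 1" and k: "k \<ge> 1" using i by (auto simp: J_def abyk)
    obtain P' Q' N where near: "near_pair r \<delta> (poly P) (poly Q) (poly P') (poly Q')"
      and top: "\<And>z. norm z \<le> real k \<Longrightarrow>
        norm ((B ^^ N) (poly (P' ^ a * Q' ^ b)) z - poly y z) \<le> 1 / (2 * real k)"
      and low: "\<And>a' b'. a' \<le> k \<Longrightarrow> b' < b \<or> b' = b \<and> a' < a \<Longrightarrow>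
        (B ^^ N) (poly (P' ^ a' * Q' ^ b')) = (\<lambda>z. 0)"
      by (rule monomial_perturbation[OF \<delta> a k, of r P Q b y]) blast
    have poly_eq: "poly (P' ^ a' * Q' ^ b') = (\<lambda>z. poly P' z ^ a' * poly Q' z ^ b')" for a' b'
      by auto
    \<comment> \<open>The box contains all smaller exponents with \<open>a' \<le> k\<close>;
      \<open>(a, b)\<close> is added since \<open>a\<close> may exceed \<open>k\<close>.\<close>
    define I where "I = insert (a, b) ({..k} \<times> {..b})"
    have "finite I" by (simp add: I_def)
    have "1 / (2 * real k) > 0" using k by simp
    from Bpow_monomials_near[OF \<open>finite I\<close> entire_intros(6)[of P'] entire_intros(6)[of Q'] this k, of N]
    obtain r' d' where d': "d' > 0"
      and cont: "\<And>f g. f \<in> entire_functions \<Longrightarrow> g \<in> entire_functions \<Longrightarrow>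
        near_pair r' d' (poly P') (poly Q') f g \<Longrightarrow>
        \<forall>(a, b)\<in>I. \<forall>z. norm z \<le> real k \<longrightarrow> norm ((B ^^ N) (\<lambda>z. f z ^ a * g z ^ b) z
          - (B ^^ N) (\<lambda>z. poly P' z ^ a * poly Q' z ^ b) z) \<le> 1 / (2 * real k)"
      by blast
    have "G i f g" if "f \<in> entire_functions" "g \<in> entire_functions"
      "near_pair r' d' (poly P') (poly Q') f g" for f g
      unfolding G_def abyk prod.case separates_def
    proof (intro exI[of _ N] allI impI conjI)
      fix z :: complex assume z: "norm z \<le> real k"
      have close: "norm ((B ^^ N) (\<lambda>z. f z ^ a' * g z ^ b') z
          - (B ^^ N) (poly (P' ^ a' * Q' ^ b')) z) \<le> 1 / (2 * real k)" if "(a', b') \<in> I" for a' b'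
        using cont[OF \<open>f \<in> _\<close> \<open>g \<in> _\<close> \<open>near_pair _ _ _ _ f g\<close>] that z unfolding poly_eq by blast
      have "(a, b) \<in> I" by (simp add: I_def)
      have "norm ((B ^^ N) (\<lambda>z. f z ^ a * g z ^ b) z - poly y z)
          \<le> 1 / (2 * real k) + 1 / (2 * real k)"
        by (rule order_trans[OF _ add_mono[OF close[OF \<open>(a, b) \<in> I\<close>] top[OF z]]])
           (rule order_trans[OF _ norm_triangle_ineq], simp)
      then show "norm ((B ^^ N) (\<lambda>z. f z ^ a * g z ^ b) z - poly y z) \<le> 1 / real k" by simp
      fix a' b' assume *: "a' \<le> k" "b' < b \<or> b' = b \<and> a' < a"
      have "(a', b') \<in> I" using * by (auto simp: I_def)
      from close[OF this] have "norm ((B ^^ N) (\<lambda>z. f z ^ a' * g z ^ b') z) \<le> 1 / (2 * real k)"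
        unfolding low[OF *] by simp
      also have "\<dots> \<le> 1 / real k" using k by (simp add: field_simps)
      finally show "norm ((B ^^ N) (\<lambda>z. f z ^ a' * g z ^ b') z) \<le> 1 / real k" .
    qed
    then show "\<exists>P' Q' r' d'. near_pair r \<delta> (poly P) (poly Q) (poly P') (poly Q') \<and> d' > 0 \<and>
        (\<forall>f\<in>entire_functions. \<forall>g\<in>entire_functions.
           near_pair r' d' (poly P') (poly Q') f g \<longrightarrow> G i f g)"
      using near d' by blast
  qed blast
  then show ?thesis by (intro that[of f g]) (auto simp: J_def G_def)
qed

text \<open>Apply \<open>separates\<close> at the leading exponent with \<open>y\<close> close to
  \<open>F\<close> divided by the leading coefficient: the leading term then lands near
  \<open>F\<close>, and all the others are sent near 0.\<close>

lemma polynomial_hypercyclic: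
  assumes f: "f \<in> entire_functions" and g: "g \<in> entire_functions"
    and D: "\<And>F r e. F \<in> entire_functions \<Longrightarrow> e > 0 \<Longrightarrow>
       \<exists>y\<in>D. \<forall>z. norm z \<le> r \<longrightarrow> norm (F z - poly y z) \<le> e"
    and sep: "\<And>a b y k. a \<ge> 1 \<Longrightarrow> y \<in> D \<Longrightarrow> k \<ge> 1 \<Longrightarrow> separates f g a b y k"
    and I: "finite I" "I \<subseteq> {(a, b). a \<ge> 1}" and c: "\<exists>p\<in>I. c p \<noteq> 0"
  shows "(\<lambda>z. \<Sum>p\<in>I. c p * (f z ^ fst p * g z ^ snd p)) \<in> hypercyclic_vectors entire_topology B"
proof (rule hypercyclic_vectorsI)
  let ?m = "\<lambda>p z. f z ^ fst p * g z ^ snd p"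
  have me: "?m p \<in> entire_functions" for p by (intro entire_intros f g)
  show he: "(\<lambda>z. \<Sum>p\<in>I. c p * ?m p z) \<in> entire_functions"
    by (intro entire_sum entire_intros f g)
  fix F :: "complex \<Rightarrow> complex" and q :: nat and e :: real
  assume F: "F \<in> entire_functions" and q: "q \<ge> 1" and e: "e > 0"
  \<comment> \<open>Zero coefficients are discarded first, so that the leading coefficient is
    non-zero.\<close>
  define I' where "I' = {p \<in> I. c p \<noteq> 0}"
  have I': "finite I'" "I' \<noteq> {}" using I c by (auto simp: I'_def)
  define b where "b = Max (snd ` I')"
  have b: "b \<in> snd ` I'" "\<And>p. p \<in> I' \<Longrightarrow> snd p \<le> b" using I' by (auto simp: b_def)
  define I'' where "I'' = {p \<in> I'. snd p = b}"
  have I'': "finite I''" "I'' \<noteq> {}" using I'(1) b(1) by (auto simp: I''_def)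
  define a where "a = Max (fst ` I'')"
  have "a \<in> fst ` I''" and amax: "\<And>p. p \<in> I'' \<Longrightarrow> fst p \<le> a" using I'' by (auto simp: a_def)
  then have abI'': "(a, b) \<in> I''" by (force simp: I''_def)
  then have abI: "(a, b) \<in> I" "c (a, b) \<noteq> 0" by (auto simp: I''_def I'_def)
  have a: "a \<ge> 1" using abI I by auto
  have smaller: "snd p < b \<or> snd p = b \<and> fst p < a" if "p \<in> I'" "p \<noteq> (a, b)" for p
  proof (cases "snd p = b")
    case True
    then have "fst p \<le> a" using amax that by (simp add: I''_def)
    then show ?thesis using that True by (cases p) auto
  next
    case False
    then show ?thesis using b(2)[OF that(1)] by simp
  qed
  define C where "C = (\<Sum>p\<in>I'. norm (c p))"
  let ?c = "c (a, b)"
  have "(\<lambda>z. (1 / ?c) * F z) \<in> entire_functions" by (intro entire_intros F)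
  moreover have "e / (2 * norm ?c) > 0" using e abI by simp
  ultimately obtain y where y: "y \<in> D"
    "\<forall>z. norm z \<le> real q \<longrightarrow> norm ((1 / ?c) * F z - poly y z) \<le> e / (2 * norm ?c)"
    using D by blast
  obtain k0 :: nat where k0: "2 * C / e \<le> real k0" using real_arch_simple by blast
  \<comment> \<open>The summands make \<open>k\<close> dominate the radius \<open>q\<close>, the
    bound \<open>2 * C / e\<close> that yields \<open>C / k \<le> e / 2\<close>, and every first
    exponent in \<open>I'\<close>.\<close>
  define k where "k = q + k0 + (\<Sum>p\<in>I'. fst p)"
  have k: "k \<ge> 1" "real q \<le> real k" "2 * C / e \<le> real k" proof -
    have "0 \<le> real (\<Sum>p\<in>I'. fst p)" by (rule of_nat_0_le_iff)
    then show "k \<ge> 1" "real q \<le> real k" "2 * C / e \<le> real k"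
      using q k0 unfolding k_def of_nat_add by linarith+
  qed
  have kI: "fst p \<le> k" if "p \<in> I'" for p
    using member_le_sum[of p I' fst] that I'(1) by (simp add: k_def)
  have Ck: "C / real k \<le> e / 2" using k(1,3) e by (simp add: field_simps)
  obtain N where N: "\<And>z. norm z \<le> real k \<Longrightarrow>
       norm ((B ^^ N) (\<lambda>z. f z ^ a * g z ^ b) z - poly y z) \<le> 1 / real k"
     "\<And>z a' b'. norm z \<le> real k \<Longrightarrow> a' \<le> k \<Longrightarrow> b' < b \<or> b' = b \<and> a' < a \<Longrightarrow>
        norm ((B ^^ N) (\<lambda>z. f z ^ a' * g z ^ b') z) \<le> 1 / real k"
    using sep[OF a y(1) k(1), of b] unfolding separates_def by blast
  have "norm ((B ^^ N) (\<lambda>z. \<Sum>p\<in>I. c p * ?m p z) z - F z) \<le> e" if z: "norm z \<le> real q" for z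
  proof -
    have zk: "norm z \<le> real k" using z k by linarith
    \<comment> \<open>The error made at each monomial, measured against \<open>y\<close> at the
      leading one and against 0 elsewhere.\<close>
    define t where "t p = (if p = (a, b) then (B ^^ N) (?m p) z - poly y z else (B ^^ N) (?m p) z)" for p
    have t: "norm (t p) \<le> 1 / real k" if "p \<in> I'" for p
      using N(1)[OF zk] N(2)[OF zk kI[OF that] smaller[OF that]] by (auto simp: t_def)
    have "(B ^^ N) (\<lambda>z. \<Sum>p\<in>I. c p * ?m p z) z = (\<Sum>p\<in>I. c p * (B ^^ N) (?m p) z)"
      using Bpow_sum[OF I(1), of ?m N c] me by simp
    also have "\<dots> = (\<Sum>p\<in>I'. c p * (B ^^ N) (?m p) z)"
      using I(1) by (intro sum.mono_neutral_right) (auto simp: I'_def)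
    also have "\<dots> = (\<Sum>p\<in>I'. c p * t p + (if p = (a, b) then ?c * poly y z else 0))"
      by (intro sum.cong) (auto simp: t_def algebra_simps)
    also have "\<dots> = (\<Sum>p\<in>I'. c p * t p) + ?c * poly y z"
      using I'(1) abI by (simp add: sum.distrib I'_def)
    finally have "(B ^^ N) (\<lambda>z. \<Sum>p\<in>I. c p * ?m p z) z - F z
        = (\<Sum>p\<in>I'. c p * t p) - ?c * ((1 / ?c) * F z - poly y z)"
      using abI by (simp add: algebra_simps)
    also have "norm \<dots> \<le> norm (\<Sum>p\<in>I'. c p * t p) + norm (?c * ((1 / ?c) * F z - poly y z))"
      by (rule norm_triangle_ineq4)
    also have "\<dots> \<le> C / real k + e / 2"
    proof (rule add_mono)
      have "norm (\<Sum>p\<in>I'. c p * t p) \<le> (\<Sum>p\<in>I'. norm (c p) * (1 / real k))"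
        unfolding norm_mult by (intro sum_norm_le) (simp only: norm_mult mult_left_mono t norm_ge_zero)
      then show "norm (\<Sum>p\<in>I'. c p * t p) \<le> C / real k"
        by (simp add: C_def sum_divide_distrib)
      have "norm (?c * ((1 / ?c) * F z - poly y z)) \<le> norm ?c * (e / (2 * norm ?c))"
        unfolding norm_mult[of ?c] using y(2) z by (intro mult_left_mono) auto
      then show "norm (?c * ((1 / ?c) * F z - poly y z)) \<le> e / 2" using abI by simp
    qed
    finally show ?thesis using Ck by linarith
  qed
  then show "\<exists>n. (B ^^ n) (\<lambda>z. \<Sum>p\<in>I. c p * ?m p z) \<in> entire_functions \<and>
      (\<forall>z. norm z \<le> real q \<longrightarrow> norm ((B ^^ n) (\<lambda>z. \<Sum>p\<in>I. c p * ?m p z) z - F z) \<le> e)"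
    using Bpow_entire[OF he] by blast
qed

lemma algebrable_hypercyclic: "algebrable (hypercyclic_vectors entire_topology B)"
proof -
  obtain D where D: "countable D" and dense: "\<And>F r e. F \<in> entire_functions \<Longrightarrow> e > 0 \<Longrightarrow>
       \<exists>y\<in>D. \<forall>z. norm z \<le> r \<longrightarrow> norm (F z - poly y z) \<le> e"
    using countable_dense_polys by metis
  obtain f g where fg: "f \<in> entire_functions" "g \<in> entire_functions"
    and sep: "\<And>a b y k. a \<ge> 1 \<Longrightarrow> y \<in> D \<Longrightarrow> k \<ge> 1 \<Longrightarrow> separates f g a b y k"
    using separating_pair[OF D] by metis
  show ?thesis
    by (rule algebrableI[OF fg zero_not_hypercyclic polynomial_hypercyclic[OF fg dense sep]])
qed

end

section \<open>The differentiation operator\<close>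

lemma shift_coeffs_maclane: "shift_coeffs maclane_weight F = fps_deriv F"
  by (intro fps_ext) (simp add: shift_coeffs_def maclane_weight_def)

lemma backward_shift_maclane:
  assumes "f \<in> entire_functions"
  shows "backward_shift maclane_weight f = deriv f"
proof
  fix z
  have "(eval_fps (taylor f) has_field_derivative eval_fps (fps_deriv (taylor f)) z) (at z)"
    by (rule has_field_derivative_eval_fps) (simp add: conv_radius_taylor assms)
  moreover have "eval_fps (taylor f) = f" using eval_taylor[OF assms] by auto
  ultimately show "backward_shift maclane_weight f z = deriv f z"
    by (simp add: backward_shift_def shift_coeffs_maclane DERIV_imp_deriv)
qed

lemma weight_prod_maclane: "weight_prod maclane_weight n = fact n"
  by (induction n) (simp_all add: weight_prod_Suc maclane_weight_def)

interpretation maclane: growing_entire_shift maclane_weight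
proof
  have "fps_conv_radius (fps_deriv (taylor f)) = \<infinity>" if "f \<in> entire_functions" for f
    using fps_conv_radius_deriv[of "taylor f"] conv_radius_taylor[OF that] by simp
  then show "entire_weighted_shift maclane_weight"
    by (simp add: entire_weighted_shift_def weight_def shift_coeffs_maclane) (simp add: maclane_weight_def)
  fix R :: real
  \<comment> \<open>The weight products are factorials, and the exponential series converges, so
    \<open>R ^ n / fact n\<close> tends to 0.\<close>
  have "(\<lambda>n. inverse (fact n) * R ^ n) \<longlonglongrightarrow> 0"
    using summable_exp[of R] by (rule summable_LIMSEQ_zero)
  then have "\<forall>\<^sub>F n in sequentially. inverse (fact n) * R ^ n < 1"
    by (rule order_tendstoD) simp
  then show "\<forall>\<^sub>F n in sequentially. R ^ n \<le> norm (weight_prod maclane_weight n)"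
    by eventually_elim (simp add: weight_prod_maclane norm_fact field_simps)
qed

text \<open>The two operators are compared only on entire functions, so the induction needs the
  invariance of that space.\<close>

lemma funpow_deriv_maclane:
  "f \<in> entire_functions \<Longrightarrow> (deriv ^^ n) f = (backward_shift maclane_weight ^^ n) f"
  by (induction n) (simp_all add: backward_shift_maclane maclane.Bpow_entire)

lemma mixing_deriv: "mixing entire_topology deriv"
proof -
  have "(deriv ^^ n) ` U = (backward_shift maclane_weight ^^ n) ` U" if "entire_open U" for U n
    using that by (intro image_cong funpow_deriv_maclane) (auto simp: entire_open_def)
  then show ?thesis
    using maclane.growing_imp_mixing unfolding mixing_def openin_entire_topology by simp
qed

lemma hypercyclic_vectors_deriv:
  "hypercyclic_vectors entire_topology deriv =
     hypercyclic_vectors entire_topology (backward_shift maclane_weight)"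
  unfolding hypercyclic_vectors_def topspace_entire_topology
  by (intro Collect_cong conj_cong) (simp_all add: funpow_deriv_maclane)

theorem corollary3p8:
  shows "(\<forall>w. entire_weighted_shift w \<longrightarrow> mixing entire_topology (backward_shift w) \<longrightarrow>
            algebrable (hypercyclic_vectors entire_topology (backward_shift w))) \<and>
         (entire_weighted_shift maclane_weight \<and>
          (\<forall>f\<in>entire_functions. backward_shift maclane_weight f = deriv f) \<and>
          mixing entire_topology deriv \<and>
          algebrable (hypercyclic_vectors entire_topology deriv))"
proof (intro conjI allI impI ballI)
  fix w assume "entire_weighted_shift w" and mix: "mixing entire_topology (backward_shift w)"
  then interpret entire_shift w by unfold_locales
  interpret growing_entire_shift w by (rule mixing_imp_growing[OF mix])
  show "algebrable (hypercyclic_vectors entire_topology (backward_shift w))"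
    by (rule algebrable_hypercyclic)
qed (simp_all add: maclane.entire_shift backward_shift_maclane mixing_deriv hypercyclic_vectors_deriv
    maclane.algebrable_hypercyclic)

end
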